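(* Let $E=\{x_1,\dots,x_n\}\subset\mathbb{R}^2$ with $x_i\,\mathcal{I}\,x_j$ for all $i\neq j$. The Max-Sum-Min $p$-dispersion problem is polynomially solvable to optimality in $E$. The cases $p=2,3$ are solvable in $O(n)$ time using $O(1)$ additional memory space. The case $p=4$ (resp. $p=5$) is solvable in $O(n^2)$ (resp. $O(n^3)$) time using $O(1)$ additional memory space. For $p>5$ there is an algorithm (a dynamic programming algorithm) that solves it, returning the optimal value and an optimal selection, in $O(pn^3)$ time and $O(pn^2)$ memory space.
   Context: For $y=(y^1,y^2),z=(z^1,z^2)\in\mathbb{R}^2$ write $y\prec z$ iff $y^1<z^1$ and $y^2>z^2$, and $y\,\mathcal{I}\,z$ iff $y\prec z$ or $z\prec y$ (so $E$ is a two-dimensional Pareto front). Fix $\alpha>0$ and let $d$ be the Euclidean distance on $\mathbb{R}^2$. For an integer $2\le p\le n$, let $D_p$ be the set of $p$-tuples $(z_1,\dots,z_p)\in E^p$ of pairwise distinct points. The Max-Sum-Min $p$-dispersion problem is $\max_{(z_1,\dots,z_p)\in D_p}\sum_{i=1}^{p}\min_{j\neq i,\,1\le j\le p}d(z_i,z_j)^\alpha$. Complexities are in a model where arithmetic operations, comparisons and evaluation of $d(\cdot,\cdot)^\alpha$ take $O(1)$ time; "additional memory space" excludes the storage of the input. *)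

theory Defs
  imports "HOL-Analysis.Analysis"
begin

type_synonym pt = "real \<times> real"

definition prec :: "pt \<Rightarrow> pt \<Rightarrow> bool" where
  "prec y z \<longleftrightarrow> fst y < fst z \<and> snd y > snd z"

definition incomp :: "pt \<Rightarrow> pt \<Rightarrow> bool" where
  "incomp y z \<longleftrightarrow> prec y z \<or> prec z y"

definition pareto_front :: "pt list \<Rightarrow> bool" where
  "pareto_front xs \<longleftrightarrow>
     (\<forall>i<length xs. \<forall>j<length xs. i \<noteq> j \<longrightarrow> incomp (xs ! i) (xs ! j))"

text \<open>dist on real*real is the Euclidean distance (product metric).\<close>
definition dispersion :: "real \<Rightarrow> pt list \<Rightarrow> real" where
  "dispersion \<alpha> zs =
     (\<Sum>i<length zs. Min {dist (zs ! i) (zs ! j) powr \<alpha> | j. j < length zs \<and> j \<noteq> i})"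

definition tuples :: "nat \<Rightarrow> pt set \<Rightarrow> pt list set" where
  "tuples p E = {zs. length zs = p \<and> distinct zs \<and> set zs \<subseteq> E}"

definition opt_value :: "real \<Rightarrow> nat \<Rightarrow> pt set \<Rightarrow> real" where
  "opt_value \<alpha> p E = Max (dispersion \<alpha> ` tuples p E)"

text \<open>Registers hold reals; indirect addressing uses nat (floor r). The input points,
  n and p are accessible read-only (not stored in registers), so the registers touched
  are exactly the additional memory used.\<close>

datatype instr =
    Const nat real
  | Add nat nat nat | Sub nat nat nat | Mul nat nat nat | Divide nat nat nat
  | Floor nat nat
  | Copy nat nat
  | LoadInd nat nat
  | StoreInd nat nat
  | GetN nat | GetP nat
  | GetX nat nat | GetY nat nat
  | DistPow nat nat nat
  | JumpLeq nat nat nat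
  | Jump nat
  | Halt

type_synonym regs = "nat \<Rightarrow> real"
type_synonym conf = "nat \<times> regs"

definition idx :: "real \<Rightarrow> nat" where "idx x = nat \<lfloor>x\<rfloor>"

definition inpt :: "pt list \<Rightarrow> nat \<Rightarrow> pt" where
  "inpt xs k = (if k < length xs then xs ! k else (0, 0))"

fun exec :: "real \<Rightarrow> pt list \<Rightarrow> nat \<Rightarrow> instr \<Rightarrow> conf \<Rightarrow> conf" where
  "exec \<alpha> xs p (Const i c) (pc, r) = (Suc pc, r(i := c))"
| "exec \<alpha> xs p (Add i j k) (pc, r) = (Suc pc, r(i := r j + r k))"
| "exec \<alpha> xs p (Sub i j k) (pc, r) = (Suc pc, r(i := r j - r k))"
| "exec \<alpha> xs p (Mul i j k) (pc, r) = (Suc pc, r(i := r j * r k))"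
| "exec \<alpha> xs p (Divide i j k) (pc, r) = (Suc pc, r(i := r j / r k))"
| "exec \<alpha> xs p (Floor i j) (pc, r) = (Suc pc, r(i := of_int \<lfloor>r j\<rfloor>))"
| "exec \<alpha> xs p (Copy i j) (pc, r) = (Suc pc, r(i := r j))"
| "exec \<alpha> xs p (LoadInd i j) (pc, r) = (Suc pc, r(i := r (idx (r j))))"
| "exec \<alpha> xs p (StoreInd i j) (pc, r) = (Suc pc, r(idx (r i) := r j))"
| "exec \<alpha> xs p (GetN i) (pc, r) = (Suc pc, r(i := real (length xs)))"
| "exec \<alpha> xs p (GetP i) (pc, r) = (Suc pc, r(i := real p))"
| "exec \<alpha> xs p (GetX i j) (pc, r) = (Suc pc, r(i := fst (inpt xs (idx (r j)))))"
| "exec \<alpha> xs p (GetY i j) (pc, r) = (Suc pc, r(i := snd (inpt xs (idx (r j)))))"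
| "exec \<alpha> xs p (DistPow i j k) (pc, r) =
     (Suc pc, r(i := dist (inpt xs (idx (r j))) (inpt xs (idx (r k))) powr \<alpha>))"
| "exec \<alpha> xs p (JumpLeq i j l) (pc, r) = (if r i \<le> r j then l else Suc pc, r)"
| "exec \<alpha> xs p (Jump l) (pc, r) = (l, r)"
| "exec \<alpha> xs p Halt (pc, r) = (pc, r)"

fun touched :: "instr \<Rightarrow> regs \<Rightarrow> nat set" where
  "touched (Const i c) r = {i}"
| "touched (Add i j k) r = {i, j, k}"
| "touched (Sub i j k) r = {i, j, k}"
| "touched (Mul i j k) r = {i, j, k}"
| "touched (Divide i j k) r = {i, j, k}"
| "touched (Floor i j) r = {i, j}"
| "touched (Copy i j) r = {i, j}"
| "touched (LoadInd i j) r = {i, j, idx (r j)}"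
| "touched (StoreInd i j) r = {i, j, idx (r i)}"
| "touched (GetN i) r = {i}"
| "touched (GetP i) r = {i}"
| "touched (GetX i j) r = {i, j}"
| "touched (GetY i j) r = {i, j}"
| "touched (DistPow i j k) r = {i, j, k}"
| "touched (JumpLeq i j l) r = {i, j}"
| "touched (Jump l) r = {}"
| "touched Halt r = {}"

definition halted :: "instr list \<Rightarrow> conf \<Rightarrow> bool" where
  "halted prog c \<longleftrightarrow> fst c \<ge> length prog \<or> prog ! fst c = Halt"

definition step :: "instr list \<Rightarrow> real \<Rightarrow> pt list \<Rightarrow> nat \<Rightarrow> conf \<Rightarrow> conf" where
  "step prog \<alpha> xs p c = (if halted prog c then c else exec \<alpha> xs p (prog ! fst c) c)"

definition run :: "instr list \<Rightarrow> real \<Rightarrow> pt list \<Rightarrow> nat \<Rightarrow> nat \<Rightarrow> conf" where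
  "run prog \<alpha> xs p t = (step prog \<alpha> xs p ^^ t) (0, \<lambda>_. 0)"

definition space_used :: "instr list \<Rightarrow> real \<Rightarrow> pt list \<Rightarrow> nat \<Rightarrow> nat \<Rightarrow> nat" where
  "space_used prog \<alpha> xs p t =
     card (\<Union>s<t. (let c = run prog \<alpha> xs p s in touched (prog ! fst c) (snd c)))"

definition correct_output :: "real \<Rightarrow> pt list \<Rightarrow> nat \<Rightarrow> regs \<Rightarrow> bool" where
  "correct_output \<alpha> xs p r \<longleftrightarrow>
     (let ks = map (\<lambda>i. idx (r (Suc i))) [0..<p]; zs = map (\<lambda>k. xs ! k) ks in
       (\<forall>k\<in>set ks. k < length xs) \<and> zs \<in> tuples p (set xs) \<and>
       dispersion \<alpha> zs = opt_value \<alpha> p (set xs) \<and> r 0 = opt_value \<alpha> p (set xs))"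

definition solves_within ::
  "instr list \<Rightarrow> real \<Rightarrow> pt list \<Rightarrow> nat \<Rightarrow> real \<Rightarrow> real \<Rightarrow> bool" where
  "solves_within prog \<alpha> xs p T S \<longleftrightarrow>
     (\<exists>t. real t \<le> T \<and> halted prog (run prog \<alpha> xs p t) \<and>
          real (space_used prog \<alpha> xs p t) \<le> S \<and>
          correct_output \<alpha> xs p (snd (run prog \<alpha> xs p t)))"

definition valid_instance :: "pt list \<Rightarrow> nat \<Rightarrow> bool" where
  "valid_instance xs p \<longleftrightarrow> 2 \<le> p \<and> p \<le> length xs \<and> pareto_front xs"

end

theory Submission
  imports Defs
begin

text \<open>In a selection ordered along the front the nearest neighbour of a point is one of its two
  neighbours in the selection, because distances on the front grow when an interval is enlarged.
  Hence the objective is a sum over consecutive distances.  Moving the outermost points to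
  the extremes of the front does not decrease it, so \<open>p - 2\<close> inner points remain to be searched
  exhaustively.  For general \<open>p\<close>, the value of the part of a selection that starts with two
  given points obeys a recursion over the third point, with \<open>p n\<^sup>2\<close> states and \<open>n\<close>
  transitions each.  Neither algorithm sorts the input: a candidate is merely required to have
  increasing first coordinates.\<close>

section \<open>Structured programs\<close>

text \<open>The two algorithms differ in how many values of \<open>p\<close> one program serves. For
  fixed \<open>p\<close> there is one program per \<open>q = p - 2\<close>: loops along a selection
  are unrolled, constants may depend on \<open>q\<close>, and a single counter up to
  \<open>n ^ q\<close> replaces \<open>q\<close> nested loops. A sorted copy of the read-only input
  would already take \<open>n\<close> registers; enumerating unsorted index tuples instead keeps
  both the space constant and the order \<open>n ^ q\<close> of the search. The dynamic program
  reads \<open>p\<close> from the input. Its states are pairs of points because a point put in front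
  of a chain fixes the term of its successor, and that term involves both neighbours. All values are
  sums of powers of distances and hence nonnegative, so \<open>-1\<close> can mark the absence of a
  chain in both algorithms. The result must end up in registers \<open>0..p\<close>. The exhaustive
  search keeps its working registers above \<open>p = q + 2\<close>; in the dynamic program
  \<open>p\<close> is not known to the code, the two areas overlap, and a buffer with a final
  relocation is required.\<close>

lemma solves_within_mono:
  "solves_within prog \<alpha> xs p T S \<Longrightarrow> T \<le> T' \<Longrightarrow> S \<le> S' \<Longrightarrow> solves_within prog \<alpha> xs p T' S'"
  unfolding solves_within_def by (meson order_trans)

datatype cmd =
    Blk "instr list"
  | Seq cmd cmd
  | IfLe nat nat cmd cmd
  | WhileLt nat nat cmd

fun code_size :: "cmd \<Rightarrow> nat" where
  "code_size (Blk is) = length is"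
| "code_size (Seq a b) = code_size a + code_size b"
| "code_size (IfLe i j a b) = code_size a + code_size b + 2"
| "code_size (WhileLt i j a) = code_size a + 2"

text \<open>The number is the address at which the code is placed, because jump targets are
  absolute. The else-branch comes first since \<open>JumpLeq\<close> falls through when the
  comparison fails.\<close>

fun comp :: "nat \<Rightarrow> cmd \<Rightarrow> instr list" where
  "comp l (Blk is) = is"
| "comp l (Seq a b) = comp l a @ comp (l + code_size a) b"
| "comp l (IfLe i j a b) =
     JumpLeq i j (l + code_size b + 2) # comp (l + 1) b @
     Jump (l + code_size b + 2 + code_size a) # comp (l + code_size b + 2) a"
| "comp l (WhileLt i j a) =
     JumpLeq j i (l + code_size a + 2) # comp (l + 1) a @ [Jump l]"

lemma length_comp [simp]: "length (comp l c) = code_size c"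
  by (induction c arbitrary: l) auto

fun basic :: "instr \<Rightarrow> bool" where
  "basic (JumpLeq i j l) = False"
| "basic (Jump l) = False"
| "basic Halt = False"
| "basic _ = True"

text \<open>The value on loops is irrelevant, since \<open>wp\<close> below is false for them.\<close>

fun cost :: "cmd \<Rightarrow> nat" where
  "cost (Blk is) = length is"
| "cost (Seq a b) = cost a + cost b"
| "cost (IfLe i j a b) = 2 + max (cost a) (cost b)"
| "cost (WhileLt i j a) = 0"

fun seqs :: "cmd list \<Rightarrow> cmd" where
  "seqs [] = Blk []"
| "seqs (c # cs) = Seq c (seqs cs)"

lemma floor_div_nat: "real_of_int \<lfloor>real a / real b\<rfloor> = real (a div b)"
  by (simp add: floor_divide_of_nat_eq)

lemma real_mod: "real a - real (a div b) * real b = real (a mod b)"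
  by (metis minus_div_mult_eq_mod of_nat_diff of_nat_mult times_div_less_eq_dividend mult.commute)

lemma idx_of_nat [simp]: "idx (real k) = k"
  by (simp add: idx_def)

lemma idx_add [simp]: "idx (real a + real b) = a + b"
  using idx_of_nat[of "a + b"] by simp

text \<open>\<open>mem\<close> bounds the addresses of all touched registers; this is how space is accounted for.\<close>

locale ram =
  fixes \<alpha> :: real and xs :: "pt list" and p :: nat and mem :: nat
begin

definition exec1 :: "instr \<Rightarrow> regs \<Rightarrow> regs" where
  "exec1 i r = snd (exec \<alpha> xs p i (0, r))"

lemma exec_basic: "basic i \<Longrightarrow> exec \<alpha> xs p i (pc, r) = (Suc pc, exec1 i r)"
  by (cases i) (auto simp: exec1_def)

lemma exec1_simps [simp]:
  "exec1 (Const i c) r = r(i := c)"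
  "exec1 (Add i j k) r = r(i := r j + r k)"
  "exec1 (Sub i j k) r = r(i := r j - r k)"
  "exec1 (Mul i j k) r = r(i := r j * r k)"
  "exec1 (Divide i j k) r = r(i := r j / r k)"
  "exec1 (Floor i j) r = r(i := of_int \<lfloor>r j\<rfloor>)"
  "exec1 (Copy i j) r = r(i := r j)"
  "exec1 (LoadInd i j) r = r(i := r (idx (r j)))"
  "exec1 (StoreInd i j) r = r(idx (r i) := r j)"
  "exec1 (GetN i) r = r(i := real (length xs))"
  "exec1 (GetP i) r = r(i := real p)"
  "exec1 (GetX i j) r = r(i := fst (inpt xs (idx (r j))))"
  "exec1 (GetY i j) r = r(i := snd (inpt xs (idx (r j))))"
  "exec1 (DistPow i j k) r =
     r(i := dist (inpt xs (idx (r j))) (inpt xs (idx (r k))) powr \<alpha>)"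
  by (simp_all add: exec1_def)

section \<open>Bounded executions and total correctness with a time bound\<close>

definition reach :: "instr list \<Rightarrow> conf \<Rightarrow> nat \<Rightarrow> conf \<Rightarrow> bool" where
  "reach prog c t c' \<longleftrightarrow> (step prog \<alpha> xs p ^^ t) c = c' \<and>
     (\<forall>s<t. let d = (step prog \<alpha> xs p ^^ s) c in touched (prog ! fst d) (snd d) \<subseteq> {..<mem})"

lemma reach_0: "reach prog c 0 c"
  by (simp add: reach_def)

lemma reach_trans:
  assumes "reach prog c s d" "reach prog d t e"
  shows "reach prog c (s + t) e"
proof -
  let ?f = "step prog \<alpha> xs p"
  have d: "(?f ^^ s) c = d" using assms(1) by (simp add: reach_def)
  have 1: "(?f ^^ (u + s)) c = (?f ^^ u) d" for u
    using d by (simp add: funpow_add)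
  have "touched (prog ! fst ((?f ^^ u) c)) (snd ((?f ^^ u) c)) \<subseteq> {..<mem}" if "u < s + t" for u
  proof (cases "u < s")
    case True then show ?thesis using assms(1) by (simp add: reach_def Let_def)
  next
    case False
    then have "(?f ^^ u) c = (?f ^^ (u - s)) d" using 1[of "u - s"] by simp
    moreover have "u - s < t" using False that by simp
    ultimately show ?thesis using assms(2) by (simp add: reach_def Let_def)
  qed
  then show ?thesis using assms(2) 1[of t] by (simp add: reach_def Let_def add.commute)
qed

lemma reach_step:
  assumes "pc < length prog" "prog ! pc = i" "i \<noteq> Halt" "touched i r \<subseteq> {..<mem}"
    "exec \<alpha> xs p i (pc, r) = d"
  shows "reach prog (pc, r) 1 d"
  using assms by (simp add: reach_def step_def halted_def Let_def)

text \<open>A Hoare triple for total correctness. Quantifying over the surrounding code makes it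
  independent of position, so that triples compose; the registers are fixed beforehand, so loop
  bounds may depend on their contents.\<close>

definition ok :: "cmd \<Rightarrow> regs \<Rightarrow> nat \<Rightarrow> (regs \<Rightarrow> bool) \<Rightarrow> bool" where
  "ok c r T Q \<longleftrightarrow> (\<forall>pre post. \<exists>t\<le>T. \<exists>r'. Q r' \<and>
     reach (pre @ comp (length pre) c @ post) (length pre, r) t (length pre + code_size c, r'))"

lemma okE:
  assumes "ok c r T Q" "prog = pre @ comp l c @ post" "l = length pre"
  obtains t r' where "t \<le> T" "Q r'" "reach prog (l, r) t (l + code_size c, r')"
  using assms unfolding ok_def by blast

lemma ok_mono:
  assumes "ok c r T Q" "T \<le> T'" "\<And>r'. Q r' \<Longrightarrow> Q' r'"
  shows "ok c r T' Q'"
  using assms unfolding ok_def by (meson order_trans)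

lemma ok_Nil: "Q r \<Longrightarrow> ok (Blk []) r T Q"
  unfolding ok_def by (auto intro!: exI[of _ 0] reach_0 exI[of _ r])

lemma ok_Cons:
  assumes "basic i" "touched i r \<subseteq> {..<mem}" "ok (Blk is) (exec1 i r) T Q"
  shows "ok (Blk (i # is)) r (Suc T) Q"
  unfolding ok_def
proof (intro allI)
  fix pre post :: "instr list"
  let ?prog = "pre @ comp (length pre) (Blk (i # is)) @ post"
  obtain t r' where t: "t \<le> T" "Q r'"
    "reach ?prog (length pre + 1, exec1 i r) t (length pre + 1 + code_size (Blk is), r')"
    by (rule okE[OF assms(3), of ?prog "pre @ [i]" "length pre + 1" post]) auto
  have "reach ?prog (length pre, r) 1 (length pre + 1, exec1 i r)"
    using assms by (intro reach_step[where i = i]) (auto simp: exec_basic)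
  from reach_trans[OF this t(3)]
  show "\<exists>t\<le>Suc T. \<exists>r'. Q r' \<and>
     reach ?prog (length pre, r) t (length pre + code_size (Blk (i # is)), r')"
    using t by (intro exI[of _ "1 + t"] conjI exI[of _ r']) auto
qed

lemma ok_Seq:
  assumes "ok a r T (\<lambda>r'. ok b r' U Q)"
  shows "ok (Seq a b) r (T + U) Q"
  unfolding ok_def
proof (intro allI)
  fix pre post :: "instr list"
  let ?prog = "pre @ comp (length pre) (Seq a b) @ post"
  obtain t r' where t: "t \<le> T" "ok b r' U Q"
    "reach ?prog (length pre, r) t (length pre + code_size a, r')"
    by (rule okE[OF assms, of ?prog pre "length pre" "comp (length pre + code_size a) b @ post"]) auto
  obtain u s where u: "u \<le> U" "Q s"
    "reach ?prog (length pre + code_size a, r') u (length pre + code_size a + code_size b, s)"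
    by (rule okE[OF t(2), of ?prog "pre @ comp (length pre) a" "length pre + code_size a" post]) auto
  from reach_trans[OF t(3) u(3)]
  show "\<exists>t\<le>T + U. \<exists>r'. Q r' \<and>
     reach ?prog (length pre, r) t (length pre + code_size (Seq a b), r')"
    using t u by (intro exI[of _ "t + u"] conjI exI[of _ s]) (auto simp: add.assoc)
qed

lemma ok_IfLe:
  assumes "i < mem" "j < mem"
    "r i \<le> r j \<Longrightarrow> ok a r T Q" "\<not> r i \<le> r j \<Longrightarrow> ok b r T Q"
  shows "ok (IfLe i j a b) r (2 + T) Q"
  unfolding ok_def
proof (intro allI)
  fix pre post :: "instr list"
  let ?l = "length pre"
  let ?j = "JumpLeq i j (?l + code_size b + 2)"
  let ?J = "Jump (?l + code_size b + 2 + code_size a)"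
  let ?prog = "pre @ comp ?l (IfLe i j a b) @ post"
  show "\<exists>t\<le>2 + T. \<exists>r'. Q r' \<and> reach ?prog (?l, r) t (?l + code_size (IfLe i j a b), r')"
  proof (cases "r i \<le> r j")
    case True
    obtain t r' where t: "t \<le> T" "Q r'"
      "reach ?prog (?l + code_size b + 2, r) t (?l + code_size b + 2 + code_size a, r')"
      by (rule okE[OF assms(3)[OF True], of ?prog
            "pre @ ?j # comp (?l + 1) b @ [?J]" "?l + code_size b + 2" post]) auto
    have "reach ?prog (?l, r) 1 (?l + code_size b + 2, r)"
      using True assms(1,2) by (intro reach_step[where i = ?j]) auto
    from reach_trans[OF this t(3)] show ?thesis
      using t by (intro exI[of _ "1 + t"] conjI exI[of _ r']) (auto simp: ac_simps)
  next
    case False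
    obtain t r' where t: "t \<le> T" "Q r'"
      "reach ?prog (?l + 1, r) t (?l + 1 + code_size b, r')"
      by (rule okE[OF assms(4)[OF False], of ?prog "pre @ [?j]" "?l + 1"
            "?J # comp (?l + code_size b + 2) a @ post"]) auto
    have 1: "reach ?prog (?l, r) 1 (?l + 1, r)"
      using False assms(1,2) by (intro reach_step[where i = ?j]) auto
    have "reach ?prog (?l + 1 + code_size b, r') 1 (?l + code_size b + 2 + code_size a, r')"
      by (intro reach_step[where i = ?J]) (auto simp: nth_append)
    from reach_trans[OF reach_trans[OF 1 t(3)] this] show ?thesis
      using t by (intro exI[of _ "1 + t + 1"] conjI exI[of _ r']) (auto simp: ac_simps)
  qed
qed

lemma ok_WhileLt_unfold:
  assumes "i < mem" "j < mem"
    "r i < r j \<Longrightarrow> ok a r T (\<lambda>r'. ok (WhileLt i j a) r' U Q)"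
    "\<not> r i < r j \<Longrightarrow> Q r"
    "r i < r j \<Longrightarrow> T + U + 2 \<le> V" "1 \<le> V"
  shows "ok (WhileLt i j a) r V Q"
  unfolding ok_def
proof (intro allI)
  fix pre post :: "instr list"
  let ?l = "length pre"
  let ?j = "JumpLeq j i (?l + code_size a + 2)"
  let ?prog = "pre @ comp ?l (WhileLt i j a) @ post"
  show "\<exists>t\<le>V. \<exists>r'. Q r' \<and> reach ?prog (?l, r) t (?l + code_size (WhileLt i j a), r')"
  proof (cases "r i < r j")
    case False
    have "reach ?prog (?l, r) 1 (?l + code_size a + 2, r)"
      using False assms(1,2) by (intro reach_step[where i = ?j]) auto
    then show ?thesis
      using assms(4)[OF False] assms(6) by (intro exI[of _ 1] conjI exI[of _ r]) (auto simp: ac_simps)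
  next
    case True
    obtain t r' where t: "t \<le> T" "ok (WhileLt i j a) r' U Q"
      "reach ?prog (?l + 1, r) t (?l + 1 + code_size a, r')"
      by (rule okE[OF assms(3)[OF True], of ?prog "pre @ [?j]" "?l + 1" "Jump ?l # post"]) auto
    have 1: "reach ?prog (?l, r) 1 (?l + 1, r)"
      using True assms(1,2) by (intro reach_step[where i = ?j]) auto
    have 2: "reach ?prog (?l + 1 + code_size a, r') 1 (?l, r')"
      by (intro reach_step[where i = "Jump ?l"]) (auto simp: nth_append)
    obtain u s where u: "u \<le> U" "Q s"
      "reach ?prog (?l, r') u (?l + code_size (WhileLt i j a), s)"
      by (rule okE[OF t(2), of ?prog pre ?l post]) auto
    from reach_trans[OF reach_trans[OF reach_trans[OF 1 t(3)] 2] u(3)] show ?thesis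
      using t u assms(5)[OF True] by (intro exI[of _ "1 + t + 1 + u"] conjI exI[of _ s]) auto
  qed
qed

text \<open>The number \<open>K\<close> of rounds is known in advance, so the round number serves as
  both invariant index and variant. Each round pays for its test and its jump back, and the failing
  test at the end costs one more step.\<close>

lemma ok_WhileLt:
  assumes "i < mem" "j < mem"
    and step: "\<And>k r. k < K \<Longrightarrow> I k r \<Longrightarrow> r i < r j \<and> ok a r T (I (Suc k))"
    and last: "\<And>r. I K r \<Longrightarrow> \<not> r i < r j \<and> Q r"
    and "I 0 r"
  shows "ok (WhileLt i j a) r (K * (T + 2) + 1) Q"
proof -
  have "ok (WhileLt i j a) r ((K - k) * (T + 2) + 1) Q" if "k \<le> K" "I k r" for k r
    using that
  proof (induction "K - k" arbitrary: k r)
    case 0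
    then have "k = K" by simp
    with 0 last show ?case
      by (intro ok_WhileLt_unfold[where T = 0 and U = 0]) (auto simp: assms)
  next
    case (Suc d)
    then have k: "k < K" by simp
    note s = step[OF k Suc.prems(2)]
    have "ok (WhileLt i j a) r' (d * (T + 2) + 1) Q" if "I (Suc k) r'" for r'
    proof -
      have d: "d = K - Suc k" using Suc.hyps(2) by simp
      show ?thesis unfolding d
        by (rule Suc.hyps(1)[OF d _ that]) (use k in simp)
    qed
    then have "ok a r T (\<lambda>r'. ok (WhileLt i j a) r' (d * (T + 2) + 1) Q)"
      using s by (blast intro: ok_mono[OF _ order_refl])
    moreover have "T + (d * (T + 2) + 1) + 2 \<le> (K - k) * (T + 2) + 1"
      using Suc.hyps(2)[symmetric] by simp
    ultimately show ?case
      using s by (intro ok_WhileLt_unfold[where T = T and U = "d * (T + 2) + 1"]) (auto simp: assms)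
  qed
  from this[of 0 r] show ?thesis using assms by simp
qed

section \<open>Weakest preconditions of loop-free code\<close>

fun wp_blk :: "instr list \<Rightarrow> regs \<Rightarrow> (regs \<Rightarrow> bool) \<Rightarrow> bool" where
  "wp_blk [] r Q = Q r"
| "wp_blk (i # is) r Q = (basic i \<and> touched i r \<subseteq> {..<mem} \<and> wp_blk is (exec1 i r) Q)"

text \<open>For loop-free code the static \<open>cost\<close> bounds the running time, so time and
  functional behaviour separate and the simplifier can execute the code symbolically. Loops are left
  to \<open>ok_WhileLt\<close>.\<close>

fun wp :: "cmd \<Rightarrow> regs \<Rightarrow> (regs \<Rightarrow> bool) \<Rightarrow> bool" where
  "wp (Blk is) r Q = wp_blk is r Q"
| "wp (Seq a b) r Q = wp a r (\<lambda>r'. wp b r' Q)"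
| "wp (IfLe i j a b) r Q =
     (i < mem \<and> j < mem \<and> (r i \<le> r j \<longrightarrow> wp a r Q) \<and> (\<not> r i \<le> r j \<longrightarrow> wp b r Q))"
| "wp (WhileLt i j a) r Q = False"

lemma ok_wp_blk: "wp_blk is r Q \<Longrightarrow> ok (Blk is) r (length is) Q"
  by (induction "is" arbitrary: r) (auto intro: ok_Nil ok_Cons)

lemma wp_mono: "wp c r Q \<Longrightarrow> (\<And>r'. Q r' \<Longrightarrow> Q' r') \<Longrightarrow> wp c r Q'"
proof (induction c arbitrary: r Q Q')
  case (Blk "is") then show ?case by (induction "is" arbitrary: r) auto
next
  case (Seq a b)
  from Seq.prems(1) have "wp a r (\<lambda>r'. wp b r' Q)" by simp
  then have "wp a r (\<lambda>r'. wp b r' Q')" by (rule Seq.IH(1)) (rule Seq.IH(2)[OF _ Seq.prems(2)])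
  then show ?case by simp
next
  case (IfLe i j a b)
  then show ?case by (metis wp.simps(3))
qed auto

lemma wp_SeqI: "wp a r P \<Longrightarrow> (\<And>r'. P r' \<Longrightarrow> wp b r' Q) \<Longrightarrow> wp (Seq a b) r Q"
  by (auto intro: wp_mono)

lemma ok_wp: "wp c r Q \<Longrightarrow> ok c r (cost c) Q"
proof (induction c arbitrary: r Q)
  case (Seq a b)
  have "ok a r (cost a) (\<lambda>r'. wp b r' Q)" using Seq.prems by (intro Seq.IH(1)) simp
  then have "ok a r (cost a) (\<lambda>r'. ok b r' (cost b) Q)"
    by (rule ok_mono[OF _ order_refl]) (rule Seq.IH(2))
  then show ?case by (simp add: ok_Seq)
next
  case (IfLe i j a b)
  have "ok (IfLe i j a b) r (2 + max (cost a) (cost b)) Q"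
    using IfLe.prems by (intro ok_IfLe) (auto intro: ok_mono[OF IfLe.IH(1)] ok_mono[OF IfLe.IH(2)])
  then show ?case by simp
qed (auto intro: ok_wp_blk)

lemma ok_wpI: "wp c r Q \<Longrightarrow> cost c \<le> T \<Longrightarrow> ok c r T Q"
  by (erule ok_mono[OF ok_wp])

lemma ok_SeqI:
  assumes "ok a r T P" "\<And>r'. P r' \<Longrightarrow> ok b r' U Q" "T + U \<le> V"
  shows "ok (Seq a b) r V Q"
  by (rule ok_mono[OF ok_Seq[OF ok_mono[OF assms(1) order_refl assms(2)]] assms(3)])

text \<open>The invariant rule for unrolled loops, whose number of rounds is fixed by the program
  text.\<close>

lemma wp_seqs_upt:
  assumes "I a r" "a \<le> b" "\<And>t r. a \<le> t \<Longrightarrow> t < b \<Longrightarrow> I t r \<Longrightarrow> wp (f t) r (I (Suc t))"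
    "\<And>r. I b r \<Longrightarrow> Q r"
  shows "wp (seqs (map f [a..<b])) r Q"
  using assms(1,3) assms(2)
proof (induction "b - a" arbitrary: a r)
  case 0
  then show ?case using assms(4) by simp
next
  case (Suc d)
  then have "wp (f a) r (I (Suc a))" by simp
  then have "wp (f a) r (\<lambda>r'. wp (seqs (map f [Suc a..<b])) r' Q)"
    by (rule wp_mono) (use Suc in \<open>intro Suc.hyps(1); simp\<close>)
  then show ?case using Suc.hyps(2) by (simp add: upt_conv_Cons)
qed

text \<open>Running past the last instruction counts as halting. All touched addresses lie in
  \<open>{..<mem}\<close>, whose cardinality is the space bound.\<close>

lemma solves_withinI:
  assumes "ok c (\<lambda>_. 0) T (correct_output \<alpha> xs p)" "real T \<le> T'" "real mem \<le> S"
  shows "solves_within (comp 0 c) \<alpha> xs p T' S"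
proof -
  obtain t r' where t: "t \<le> T" "correct_output \<alpha> xs p r'"
    "reach (comp 0 c) (0, \<lambda>_. 0) t (0 + code_size c, r')"
    by (rule okE[OF assms(1), of "comp 0 c" "[]" 0 "[]"]) auto
  then have run: "run (comp 0 c) \<alpha> xs p t = (code_size c, r')"
    by (simp add: run_def reach_def)
  have "(\<Union>s<t. (let d = run (comp 0 c) \<alpha> xs p s in touched (comp 0 c ! fst d) (snd d))) \<subseteq> {..<mem}"
    using t(3) by (auto simp: run_def reach_def Let_def)
  from card_mono[OF _ this] have "space_used (comp 0 c) \<alpha> xs p t \<le> mem"
    by (simp add: space_used_def)
  with t run assms(2,3) show ?thesis
    unfolding solves_within_def by (intro exI[of _ t]) (auto simp: halted_def)
qed

end

section \<open>Dispersion along a Pareto front\<close>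

definition chain :: "pt list \<Rightarrow> bool" where
  "chain zs \<longleftrightarrow> sorted_wrt (\<lambda>a b. fst a < fst b) zs"

definition front :: "pt set \<Rightarrow> bool" where
  "front E \<longleftrightarrow> (\<forall>x\<in>E. \<forall>y\<in>E. x \<noteq> y \<longrightarrow> incomp x y)"

lemma front_set: "pareto_front xs \<Longrightarrow> front (set xs)"
  unfolding pareto_front_def front_def by (metis in_set_conv_nth)

lemma front_fst_eq: "front E \<Longrightarrow> x \<in> E \<Longrightarrow> y \<in> E \<Longrightarrow> fst x = fst y \<Longrightarrow> x = y"
  unfolding front_def incomp_def prec_def by force

lemma front_snd_mono: "front E \<Longrightarrow> x \<in> E \<Longrightarrow> y \<in> E \<Longrightarrow> fst x \<le> fst y \<Longrightarrow> snd y \<le> snd x"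
  unfolding front_def incomp_def prec_def by force

text \<open>Along the front one coordinate increases and the other decreases, so enlarging an
  interval enlarges both coordinate differences and with them the Euclidean norm.\<close>

lemma front_dist_mono:
  assumes "front E" "{a, b, c, d} \<subseteq> E" "fst a \<le> fst b" "fst b \<le> fst c" "fst c \<le> fst d"
  shows "dist b c \<le> dist a d"
proof -
  have "snd b \<le> snd a" "snd c \<le> snd b" "snd d \<le> snd c"
    using assms by (auto intro: front_snd_mono[of E])
  then show ?thesis using assms(3-5)
    unfolding dist_prod_def
    by (intro real_sqrt_le_mono add_mono power_mono) (auto simp: dist_real_def)
qed

definition gap :: "real \<Rightarrow> pt list \<Rightarrow> nat \<Rightarrow> real" where
  "gap \<alpha> zs t = dist (zs ! t) (zs ! Suc t) powr \<alpha>"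

text \<open>The contribution of all points but the first to the objective. The first point is left
  out because its nearest neighbour may change when another point is put in front of it.\<close>

definition tailval :: "real \<Rightarrow> pt list \<Rightarrow> real" where
  "tailval \<alpha> zs = (\<Sum>t<length zs - 2. min (gap \<alpha> zs t) (gap \<alpha> zs (Suc t))) + gap \<alpha> zs (length zs - 2)"

lemma gap_Cons: "gap \<alpha> (a # zs) (Suc t) = gap \<alpha> zs t"
  by (simp add: gap_def)

lemma tailval_two: "tailval \<alpha> [a, b] = dist a b powr \<alpha>"
  by (simp add: tailval_def gap_def)

text \<open>Prepending \<open>a\<close> settles the term of \<open>b\<close>, which now has both
  neighbours, and leaves all later terms alone. This locality is what makes dynamic programming
  possible.\<close>

lemma tailval_Cons:
  "tailval \<alpha> (a # b # c # zs) =
     tailval \<alpha> (b # c # zs) + min (dist b c powr \<alpha>) (dist a b powr \<alpha>)"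
  unfolding tailval_def
  by (simp add: sum.lessThan_Suc_shift gap_Cons del: sum.lessThan_Suc) (simp add: gap_def min.commute)

lemma gap_nonneg [simp]: "0 \<le> gap \<alpha> zs t"
  by (simp add: gap_def)

lemma tailval_nonneg: "0 \<le> tailval \<alpha> zs"
  by (simp add: tailval_def sum_nonneg)

lemma chain_nth_mono:
  assumes "chain zs" "i \<le> j" "j < length zs"
  shows "fst (zs ! i) \<le> fst (zs ! j)"
  using assms unfolding chain_def sorted_wrt_iff_nth_less
  by (cases "i = j") (auto simp: less_imp_le)

lemma chain_distinct: "chain zs \<Longrightarrow> distinct zs"
  unfolding chain_def distinct_conv_nth sorted_wrt_iff_nth_less
  by (metis less_irrefl linorder_neqE_nat)

lemma dispersion_chain:
  assumes E: "front E" and zs: "chain zs" "set zs \<subseteq> E" and len: "2 \<le> length zs" and \<alpha>: "0 < \<alpha>"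
  shows "dispersion \<alpha> zs = gap \<alpha> zs 0 + tailval \<alpha> zs"
proof -
  let ?n = "length zs"
  obtain m where n: "?n = Suc (Suc m)"
    using len by (metis add_2_eq_Suc le_Suc_ex)
  let ?S = "\<lambda>i. {dist (zs ! i) (zs ! j) powr \<alpha> | j. j < ?n \<and> j \<noteq> i}"
  have fin: "finite (?S i)" for i by simp
  \<comment> \<open>Positions may coincide: \<open>right\<close> and \<open>left\<close> use this
    with the point itself as a common end of both intervals.\<close>
  have mono: "dist (zs ! b) (zs ! c) powr \<alpha> \<le> dist (zs ! a) (zs ! d) powr \<alpha>"
    if "a \<le> b" "b \<le> c" "c \<le> d" "d < ?n" for a b c d
  proof -
    have "{zs ! a, zs ! b, zs ! c, zs ! d} \<subseteq> E" using that zs(2) by (auto intro!: subsetD[OF zs(2)] nth_mem)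
    then have "dist (zs ! b) (zs ! c) \<le> dist (zs ! a) (zs ! d)"
      using that by (intro front_dist_mono[OF E] chain_nth_mono[OF zs(1)]) auto
    then show ?thesis using \<alpha> by (intro powr_mono2) auto
  qed
  have right: "gap \<alpha> zs i \<le> dist (zs ! i) (zs ! j) powr \<alpha>" if "i < j" "j < ?n" for i j
    using mono[of i i "Suc i" j] that by (simp add: gap_def)
  have left: "gap \<alpha> zs (i - 1) \<le> dist (zs ! i) (zs ! j) powr \<alpha>" if "j < i" "i < ?n" for i j
    using mono[of j "i - 1" i i] that by (simp add: gap_def dist_commute)
  have ends: "gap \<alpha> zs i \<in> ?S i" "gap \<alpha> zs i \<in> ?S (Suc i)" if "Suc i < ?n" for i
    using that by (auto simp: gap_def dist_commute)
  have first: "Min (?S 0) = gap \<alpha> zs 0"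
    using ends(1)[of 0] n by (intro Min_eqI fin) (auto intro!: right)
  have last: "Min (?S (Suc m)) = gap \<alpha> zs m"
    using ends(2)[of m] n left[of _ "Suc m"] by (intro Min_eqI fin) (auto simp: less_Suc_eq)
  have mid: "Min (?S (Suc i)) = min (gap \<alpha> zs i) (gap \<alpha> zs (Suc i))" if "i < m" for i
  proof (intro Min_eqI fin)
    fix y assume "y \<in> ?S (Suc i)"
    then obtain j where j: "y = dist (zs ! Suc i) (zs ! j) powr \<alpha>" "j < ?n" "j \<noteq> Suc i" by auto
    then show "min (gap \<alpha> zs i) (gap \<alpha> zs (Suc i)) \<le> y"
      using left[of j "Suc i"] right[of "Suc i" j] that n
      by (cases "j < Suc i") (auto simp: min_le_iff_disj)
  next
    have "gap \<alpha> zs i \<in> ?S (Suc i)" "gap \<alpha> zs (Suc i) \<in> ?S (Suc i)"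
      using ends(2)[of i] ends(1)[of "Suc i"] that n by simp_all
    then show "min (gap \<alpha> zs i) (gap \<alpha> zs (Suc i)) \<in> ?S (Suc i)"
      unfolding min_def by presburger
  qed
  have "dispersion \<alpha> zs = (\<Sum>i<Suc (Suc m). Min (?S i))"
    unfolding dispersion_def n ..
  also have "\<dots> = Min (?S 0) + ((\<Sum>i<m. Min (?S (Suc i))) + Min (?S (Suc m)))"
    by (subst sum.lessThan_Suc_shift) simp
  also have "\<dots> = gap \<alpha> zs 0 + tailval \<alpha> zs"
    using first last mid by (simp add: tailval_def n)
  finally show ?thesis .
qed

text \<open>The right-hand side mentions only the set of points, so the objective does not depend on
  their order.\<close>

lemma dispersion_set:
  assumes "distinct zs"
  shows "dispersion \<alpha> zs = (\<Sum>z\<in>set zs. Min ((\<lambda>w. dist z w powr \<alpha>) ` (set zs - {z})))"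
proof -
  have S: "{dist (zs ! i) (zs ! j) powr \<alpha> | j. j < length zs \<and> j \<noteq> i} =
      (\<lambda>w. dist (zs ! i) w powr \<alpha>) ` (set zs - {zs ! i})" if "i < length zs" for i
  proof -
    have "set zs - {zs ! i} = (!) zs ` {j. j < length zs \<and> j \<noteq> i}"
      using that assms by (auto simp: set_conv_nth nth_eq_iff_index_eq)
    then show ?thesis by (auto simp: image_image)
  qed
  have "dispersion \<alpha> zs =
      (\<Sum>i<length zs. Min ((\<lambda>w. dist (zs ! i) w powr \<alpha>) ` (set zs - {zs ! i})))"
    unfolding dispersion_def by (intro sum.cong) (simp_all add: S)
  also have "\<dots> = (\<Sum>z\<in>set zs. Min ((\<lambda>w. dist z w powr \<alpha>) ` (set zs - {z})))"
    using bij_betw_nth[OF assms refl refl] by (rule sum.reindex_bij_betw)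
  finally show ?thesis .
qed

text \<open>Sorting by first coordinate preserves the objective, and the result is strictly
  increasing because distinct points of a front differ in that coordinate.\<close>

lemma ex_chain:
  assumes "front E" "distinct zs" "set zs \<subseteq> E"
  obtains zs' where "chain zs'" "set zs' = set zs" "length zs' = length zs"
    "dispersion \<alpha> zs' = dispersion \<alpha> zs"
proof
  let ?z = "sort_key fst zs"
  have d: "distinct ?z" using assms(2) by simp
  show set: "set ?z = set zs" and "length ?z = length zs" by simp_all
  show "dispersion \<alpha> ?z = dispersion \<alpha> zs"
    unfolding dispersion_set[OF d] dispersion_set[OF assms(2)] set ..
  have s: "sorted (map fst ?z)" by simp
  show "chain ?z" unfolding chain_def sorted_wrt_iff_nth_less
  proof (intro allI impI)
    fix i j assume ij: "i < j" "j < length ?z"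
    then have "fst (?z ! i) \<le> fst (?z ! j)"
      using sorted_nth_mono[OF s, of i j] by simp
    moreover have "?z ! i \<noteq> ?z ! j" using ij d by (simp add: nth_eq_iff_index_eq del: length_sort)
    moreover have "?z ! i \<in> E" "?z ! j \<in> E"
      using ij set assms(3) nth_mem[of i ?z] nth_mem[of j ?z] by auto
    ultimately show "fst (?z ! i) < fst (?z ! j)"
      using front_fst_eq[OF assms(1)] by (metis order_le_less)
  qed
qed

text \<open>The common end of both correctness proofs: by \<open>ex_chain\<close>, being best among
  chains of the same length is being best among all tuples.\<close>

lemma opt_valueI:
  assumes "front E" "finite E" "2 \<le> length zs" "chain zs" "set zs \<subseteq> E" "0 < \<alpha>"
    and "\<And>ys. chain ys \<Longrightarrow> set ys \<subseteq> E \<Longrightarrow> length ys = length zs \<Longrightarrow>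
           gap \<alpha> ys 0 + tailval \<alpha> ys \<le> gap \<alpha> zs 0 + tailval \<alpha> zs"
  shows "zs \<in> tuples (length zs) E" "dispersion \<alpha> zs = opt_value \<alpha> (length zs) E"
    "opt_value \<alpha> (length zs) E = gap \<alpha> zs 0 + tailval \<alpha> zs"
proof -
  show zs: "zs \<in> tuples (length zs) E"
    using assms chain_distinct by (auto simp: tuples_def)
  have d: "dispersion \<alpha> zs = gap \<alpha> zs 0 + tailval \<alpha> zs"
    using dispersion_chain assms by blast
  have "finite (tuples (length zs) E)"
    using finite_lists_length_eq[OF assms(2), of "length zs"]
    by (rule rev_finite_subset) (auto simp: tuples_def)
  then have "opt_value \<alpha> (length zs) E = dispersion \<alpha> zs"
    unfolding opt_value_def
  proof (intro Max_eqI)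
    fix y assume "y \<in> dispersion \<alpha> ` tuples (length zs) E"
    then obtain ys where ys: "y = dispersion \<alpha> ys" "distinct ys" "set ys \<subseteq> E" "length ys = length zs"
      by (auto simp: tuples_def)
    obtain ys' where ys': "chain ys'" "set ys' = set ys" "length ys' = length ys"
      "dispersion \<alpha> ys' = dispersion \<alpha> ys" using ex_chain[OF assms(1) ys(2,3)] by blast
    have "dispersion \<alpha> ys' = gap \<alpha> ys' 0 + tailval \<alpha> ys'"
      using ys ys' assms by (intro dispersion_chain[of E]) auto
    then show "y \<le> dispersion \<alpha> zs" using assms(7)[of ys'] ys ys' d by simp
  qed (use zs in auto)
  then show "dispersion \<alpha> zs = opt_value \<alpha> (length zs) E"
    "opt_value \<alpha> (length zs) E = gap \<alpha> zs 0 + tailval \<alpha> zs" using d by simp_all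
qed

text \<open>The objective is monotone in each consecutive distance; the replacement enlarges the
  outermost distances and keeps the others.\<close>

lemma extend_to_extremes:
  assumes E: "front E" and zs: "chain zs" "set zs \<subseteq> E" "length zs = Suc (Suc q)" and \<alpha>: "0 < \<alpha>"
    and lo: "lo \<in> E" "\<And>z. z \<in> E \<Longrightarrow> fst lo \<le> fst z" and hi: "hi \<in> E" "\<And>z. z \<in> E \<Longrightarrow> fst z \<le> fst hi"
  defines "zs' \<equiv> zs[0 := lo, Suc q := hi]"
  shows "chain zs'" "gap \<alpha> zs 0 + tailval \<alpha> zs \<le> gap \<alpha> zs' 0 + tailval \<alpha> zs'"
proof -
  have mem: "zs ! i \<in> E" if "i < Suc (Suc q)" for i
    using zs that by (metis nth_mem subsetD)
  have nth: "zs' ! i = (if i = 0 then lo else if i = Suc q then hi else zs ! i)"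
    if "i < Suc (Suc q)" for i
    using that zs by (auto simp: zs'_def nth_list_update)
  have less: "fst (zs ! i) < fst (zs ! j)" if "i < j" "j < Suc (Suc q)" for i j
    using zs that by (simp add: chain_def sorted_wrt_iff_nth_less)
  show "chain zs'"
    unfolding chain_def sorted_wrt_iff_nth_less
  proof (intro allI impI)
    fix i j assume ij: "i < j" "j < length zs'"
    then have j: "j < Suc (Suc q)" using zs by (simp add: zs'_def)
    \<comment> \<open>As \<open>i < j\<close>, position \<open>i\<close> is not the last and
      \<open>j\<close> not the first, so the replacements can only move the two points
      apart.\<close>
    have "fst (zs' ! i) \<le> fst (zs ! i)" "fst (zs ! j) \<le> fst (zs' ! j)"
      using ij j lo hi mem by (auto simp: nth)
    with less[OF ij(1) j] show "fst (zs' ! i) < fst (zs' ! j)" by linarith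
  qed
  have gap: "gap \<alpha> zs t \<le> gap \<alpha> zs' t" if t: "t < Suc q" for t
  proof -
    have "dist (zs ! t) (zs ! Suc t) \<le> dist (zs' ! t) (zs' ! Suc t)"
    proof (rule front_dist_mono[OF E])
      show "{zs' ! t, zs ! t, zs ! Suc t, zs' ! Suc t} \<subseteq> E"
        using t lo(1) hi(1) mem by (auto simp: nth)
    qed (use t lo hi mem less[of t "Suc t"] in \<open>auto simp: nth\<close>)
    then show ?thesis unfolding gap_def using \<alpha> by (intro powr_mono2) auto
  qed
  have "length zs' = length zs" by (simp add: zs'_def)
  then show "gap \<alpha> zs 0 + tailval \<alpha> zs \<le> gap \<alpha> zs' 0 + tailval \<alpha> zs'"
    unfolding tailval_def using zs(3)
    by (auto intro!: add_mono sum_mono min.mono gap)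
qed

section \<open>Exhaustive search for few points\<close>

text \<open>Registers of the exhaustive search for \<open>q + 2\<close> points: the best value so far is in register 0
  and its selection in \<open>1..q+2\<close>; \<open>q+3\<close> holds \<open>n\<close>, \<open>q+4\<close> the number 1, \<open>q+5\<close> and \<open>q+6\<close> the
  two extreme points, \<open>q+7\<close> the number of the current candidate, \<open>q+8\<close> the number \<open>n\<^sup>q\<close> of
  candidates, and \<open>q+30..2q+31\<close> the current candidate, whose inner points are the base-\<open>n\<close> digits
  of its number.  The other registers are temporary.\<close>

definition extremes :: "nat \<Rightarrow> cmd" where
  "extremes q = Seq
     (Blk [GetN (q + 3), Const (q + 4) 1, Const (q + 5) 0, Const (q + 6) 0, Const (q + 7) 0])
     (WhileLt (q + 7) (q + 3)
       (Seq (Blk [GetX (q + 9) (q + 7), GetX (q + 10) (q + 5)])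
       (Seq (IfLe (q + 10) (q + 9) (Blk []) (Blk [Copy (q + 5) (q + 7)]))
       (Seq (Blk [GetX (q + 10) (q + 6)])
       (Seq (IfLe (q + 9) (q + 10) (Blk []) (Blk [Copy (q + 6) (q + 7)]))
            (Blk [Add (q + 7) (q + 7) (q + 4)]))))))"

text \<open>Digits come least significant first: each round writes the remainder modulo
  \<open>n\<close> and continues with the quotient.\<close>

definition decode :: "nat \<Rightarrow> cmd" where
  "decode q = Seq
     (Blk [Copy (q + 9) (q + 7), Copy (q + 30) (q + 5), Copy (q + (31 + q)) (q + 6)])
     (seqs (map (\<lambda>t. Blk [Divide (q + 10) (q + 9) (q + 3), Floor (q + 10) (q + 10),
        Mul (q + (31 + t)) (q + 10) (q + 3), Sub (q + (31 + t)) (q + 9) (q + (31 + t)),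
        Copy (q + 9) (q + 10)]) [0..<q]))"

text \<open>Register \<open>q + 12\<close>, the previous gap, starts as the first gap. The first
  round therefore adds the minimum of the first gap with itself, which is the term of the first
  point; the addition after the last round is the term of the last point. Register
  \<open>q + 13\<close> records whether the candidate is increasing.\<close>

definition evaluate :: "nat \<Rightarrow> cmd" where
  "evaluate q = Seq
     (Blk [Const (q + 13) 1, Const (q + 11) 0, DistPow (q + 12) (q + 30) (q + 31)])
     (Seq (seqs (map (\<lambda>t.
        Seq (Blk [GetX (q + 9) (q + (30 + t)), GetX (q + 10) (q + (31 + t)),
                  DistPow (q + 14) (q + (30 + t)) (q + (31 + t))])
       (Seq (IfLe (q + 10) (q + 9) (Blk [Const (q + 13) 0]) (Blk []))
       (Seq (IfLe (q + 12) (q + 14) (Blk [Add (q + 11) (q + 11) (q + 12)])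
                                    (Blk [Add (q + 11) (q + 11) (q + 14)]))
            (Blk [Copy (q + 12) (q + 14)])))) [0..<Suc q]))
       (Blk [Add (q + 11) (q + 11) (q + 12)]))"

definition save :: "nat \<Rightarrow> cmd" where
  "save q = Seq (IfLe (q + 4) (q + 13)
      (IfLe (q + 11) 0 (Blk [])
         (Seq (Blk [Copy 0 (q + 11)])
              (seqs (map (\<lambda>t. Blk [Copy (Suc t) (q + (30 + t))]) [0..<Suc (Suc q)]))))
      (Blk []))
    (Blk [Add (q + 7) (q + 7) (q + 4)])"

text \<open>The initial record \<open>-1\<close> lies below every value, so the first increasing
  candidate is always saved.\<close>

definition power_loop :: "nat \<Rightarrow> cmd" where
  "power_loop q = Seq (Blk [Const (q + 8) 1])
     (Seq (seqs (map (\<lambda>t. Blk [Mul (q + 8) (q + 8) (q + 3)]) [0..<q]))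
          (Blk [Const 0 (-1), Const (q + 7) 0]))"

definition brute_force :: "nat \<Rightarrow> cmd" where
  "brute_force q = Seq (extremes q) (Seq (power_loop q)
     (WhileLt (q + 7) (q + 8) (Seq (decode q) (Seq (evaluate q) (save q)))))"

text \<open>The highest register in use is \<open>q + (31 + q)\<close>, the last point of the
  candidate.\<close>

locale brute = ram \<alpha> xs "Suc (Suc q)" "2 * q + 40" for \<alpha> :: real and xs :: "pt list" and q :: nat +
  assumes pareto: "pareto_front xs" and len: "Suc (Suc q) \<le> length xs" and alpha: "0 < \<alpha>"
begin

abbreviation "n \<equiv> length xs"

definition extremal :: "nat \<Rightarrow> nat \<Rightarrow> nat \<Rightarrow> bool" where
  "extremal k lo hi \<longleftrightarrow> lo < n \<and> hi < n \<and>
     (\<forall>j<k. fst (xs ! lo) \<le> fst (xs ! j) \<and> fst (xs ! j) \<le> fst (xs ! hi))"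

definition base :: "nat \<Rightarrow> nat \<Rightarrow> nat \<Rightarrow> regs \<Rightarrow> bool" where
  "base m lo hi r \<longleftrightarrow> r (q + 3) = real n \<and> r (q + 4) = 1 \<and> r (q + 5) = real lo \<and>
     r (q + 6) = real hi \<and> r (q + 7) = real m"

lemma extremal_Suc:
  assumes "extremal k lo hi" "k < n"
  shows "extremal (Suc k) (if fst (xs ! lo) \<le> fst (xs ! k) then lo else k)
     (if fst (xs ! k) \<le> fst (xs ! hi) then hi else k)"
  using assms unfolding extremal_def less_Suc_eq
  by (auto; meson linear order_trans)

lemma ok_extremes:
  "ok (extremes q) r (n * 12 + 6) (\<lambda>r'. \<exists>m lo hi. base m lo hi r' \<and> extremal n lo hi)"
  unfolding extremes_def
proof (rule ok_SeqI[where P = "\<lambda>r. base 0 0 0 r"])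
  show "ok (Blk [GetN (q + 3), Const (q + 4) 1, Const (q + 5) 0, Const (q + 6) 0, Const (q + 7) 0])
     r 5 (base 0 0 0)"
    by (rule ok_wpI) (simp_all add: base_def)
next
  fix r assume r: "base 0 0 0 r"
  let ?I = "\<lambda>k r. \<exists>lo hi. base k lo hi r \<and> extremal k lo hi"
  show "ok (WhileLt (q + 7) (q + 3)
       (Seq (Blk [GetX (q + 9) (q + 7), GetX (q + 10) (q + 5)])
       (Seq (IfLe (q + 10) (q + 9) (Blk []) (Blk [Copy (q + 5) (q + 7)]))
       (Seq (Blk [GetX (q + 10) (q + 6)])
       (Seq (IfLe (q + 9) (q + 10) (Blk []) (Blk [Copy (q + 6) (q + 7)]))
            (Blk [Add (q + 7) (q + 7) (q + 4)])))))) r (n * (10 + 2) + 1)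
       (\<lambda>r'. \<exists>m lo hi. base m lo hi r' \<and> extremal n lo hi)"
  proof (rule ok_WhileLt[where I = ?I], simp, simp, intro conjI ok_wpI)
    fix k r assume k: "k < n" and "?I k r"
    then obtain lo hi where I: "base k lo hi r" "extremal k lo hi" by blast
    show "r (q + 7) < r (q + 3)" using k I by (simp add: base_def)
    let ?lo = "if fst (xs ! lo) \<le> fst (xs ! k) then lo else k"
    let ?hi = "if fst (xs ! k) \<le> fst (xs ! hi) then hi else k"
    have "wp (Seq (Blk [GetX (q + 9) (q + 7), GetX (q + 10) (q + 5)])
       (Seq (IfLe (q + 10) (q + 9) (Blk []) (Blk [Copy (q + 5) (q + 7)]))
       (Seq (Blk [GetX (q + 10) (q + 6)])
       (Seq (IfLe (q + 9) (q + 10) (Blk []) (Blk [Copy (q + 6) (q + 7)]))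
            (Blk [Add (q + 7) (q + 7) (q + 4)]))))) r (base (Suc k) ?lo ?hi)"
      using I k by (auto simp: base_def extremal_def inpt_def)
    then show "wp (Seq (Blk [GetX (q + 9) (q + 7), GetX (q + 10) (q + 5)])
       (Seq (IfLe (q + 10) (q + 9) (Blk []) (Blk [Copy (q + 5) (q + 7)]))
       (Seq (Blk [GetX (q + 10) (q + 6)])
       (Seq (IfLe (q + 9) (q + 10) (Blk []) (Blk [Copy (q + 6) (q + 7)]))
            (Blk [Add (q + 7) (q + 7) (q + 4)]))))) r (?I (Suc k))"
      by (rule wp_mono) (use extremal_Suc[OF I(2) k] in blast)
  qed (use r len in \<open>auto simp: base_def extremal_def\<close>)
qed simp

section \<open>Candidates as numbers in base \<open>n\<close>\<close>

definition cand :: "nat \<Rightarrow> nat \<Rightarrow> nat \<Rightarrow> nat list" where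
  "cand lo hi m = lo # map (\<lambda>t. m div n ^ t mod n) [0..<q] @ [hi]"

lemma length_cand [simp]: "length (cand lo hi m) = Suc (Suc q)"
  by (simp add: cand_def)

lemma cand_nth [simp]:
  "cand lo hi m ! 0 = lo" "cand lo hi m ! Suc q = hi"
  "t < q \<Longrightarrow> cand lo hi m ! Suc t = m div n ^ t mod n"
  by (simp_all add: cand_def nth_append)

lemma n_pos: "0 < n" using len by linarith

lemma position_cases:
  assumes "P 0" "P (Suc q)" "\<And>t. t < q \<Longrightarrow> P (Suc t)" "t < Suc (Suc q)"
  shows "P t"
  using assms by (metis less_antisym not0_implies_Suc Suc_less_eq)

lemma cand_less:
  assumes "lo < n" "hi < n" "t < Suc (Suc q)"
  shows "cand lo hi m ! t < n"
  using assms n_pos by (intro position_cases[OF _ _ _ assms(3), of "\<lambda>t. cand lo hi m ! t < n"])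
    (simp_all del: length_greater_0_conv)

definition digits :: "nat \<Rightarrow> nat \<Rightarrow> nat \<Rightarrow> regs \<Rightarrow> bool" where
  "digits lo hi m r \<longleftrightarrow> (\<forall>t<Suc (Suc q). r (q + (30 + t)) = real (cand lo hi m ! t))"

lemma wp_decode:
  assumes "base m lo hi r"
  shows "wp (decode q) r (\<lambda>r'. digits lo hi m r' \<and> (\<forall>a<q + 9. r' a = r a))"
  unfolding decode_def
proof (rule wp_SeqI[where P = "\<lambda>r'. r' (q + 9) = real m \<and> r' (q + 30) = real lo \<and>
      r' (q + (31 + q)) = real hi \<and> (\<forall>a<q + 9. r' a = r a)"], use assms in \<open>simp add: base_def\<close>)
  fix s assume s: "s (q + 9) = real m \<and> s (q + 30) = real lo \<and>
      s (q + (31 + q)) = real hi \<and> (\<forall>a<q + 9. s a = r a)"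
  show "wp (seqs (map (\<lambda>t. Blk [Divide (q + 10) (q + 9) (q + 3), Floor (q + 10) (q + 10),
        Mul (q + (31 + t)) (q + 10) (q + 3), Sub (q + (31 + t)) (q + 9) (q + (31 + t)),
        Copy (q + 9) (q + 10)]) [0..<q])) s (\<lambda>r'. digits lo hi m r' \<and> (\<forall>a<q + 9. r' a = r a))"
  proof (rule wp_seqs_upt[where I = "\<lambda>t r'. r' (q + 9) = real (m div n ^ t) \<and> r' (q + 30) = real lo \<and>
      r' (q + (31 + q)) = real hi \<and> (\<forall>u<t. r' (q + (31 + u)) = real (m div n ^ u mod n)) \<and>
      (\<forall>a<q + 9. r' a = r a)"])
    fix t r' assume t: "t < q" and r': "r' (q + 9) = real (m div n ^ t) \<and> r' (q + 30) = real lo \<and>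
      r' (q + (31 + q)) = real hi \<and> (\<forall>u<t. r' (q + (31 + u)) = real (m div n ^ u mod n)) \<and>
      (\<forall>a<q + 9. r' a = r a)"
    then have "r' (q + 3) = real n" using assms by (simp add: base_def)
    then show "wp (Blk [Divide (q + 10) (q + 9) (q + 3), Floor (q + 10) (q + 10),
        Mul (q + (31 + t)) (q + 10) (q + 3), Sub (q + (31 + t)) (q + 9) (q + (31 + t)),
        Copy (q + 9) (q + 10)]) r' (\<lambda>r'. r' (q + 9) = real (m div n ^ Suc t) \<and> r' (q + 30) = real lo \<and>
      r' (q + (31 + q)) = real hi \<and> (\<forall>u<Suc t. r' (q + (31 + u)) = real (m div n ^ u mod n)) \<and>
      (\<forall>a<q + 9. r' a = r a))"
      using t r' by (auto simp: floor_div_nat real_mod less_Suc_eq div_mult2_eq mult.commute[of n])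
  next
    fix r' assume r': "r' (q + 9) = real (m div n ^ q) \<and> r' (q + 30) = real lo \<and>
      r' (q + (31 + q)) = real hi \<and> (\<forall>u<q. r' (q + (31 + u)) = real (m div n ^ u mod n)) \<and>
      (\<forall>a<q + 9. r' a = r a)"
    have "r' (q + (30 + t)) = real (cand lo hi m ! t)" if "t < Suc (Suc q)" for t
      by (rule position_cases[OF _ _ _ that]) (use r' in auto)
    then show "digits lo hi m r' \<and> (\<forall>a<q + 9. r' a = r a)"
      using r' by (simp add: digits_def)
  qed (use s in auto)
qed

definition pts :: "nat \<Rightarrow> nat \<Rightarrow> nat \<Rightarrow> pt list" where
  "pts lo hi m = map ((!) xs) (cand lo hi m)"

lemma length_pts [simp]: "length (pts lo hi m) = Suc (Suc q)"
  by (simp add: pts_def)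

lemma pts_nth: "t < Suc (Suc q) \<Longrightarrow> pts lo hi m ! t = xs ! (cand lo hi m ! t)"
  by (simp add: pts_def)

definition val :: "pt list \<Rightarrow> real" where
  "val zs = gap \<alpha> zs 0 + tailval \<alpha> zs"

lemma chain_Suc: "chain zs \<longleftrightarrow> (\<forall>t<length zs - 1. fst (zs ! t) < fst (zs ! Suc t))"
  unfolding chain_def by (subst sorted_wrt_iff_nth_Suc_transp) (auto simp: transp_def less_diff_conv)

lemma wp_evaluate:
  assumes "digits lo hi m r" "lo < n" "hi < n"
  shows "wp (evaluate q) r (\<lambda>r'. digits lo hi m r' \<and> r' (q + 11) = val (pts lo hi m) \<and>
     r' (q + 13) = (if chain (pts lo hi m) then 1 else 0) \<and> (\<forall>a<q + 9. r' a = r a))"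
proof -
  let ?z = "pts lo hi m"
  let ?g = "gap \<alpha> ?z"
  \<comment> \<open>Truncated subtraction is intended: for \<open>s = 0\<close> the summand is the
    first gap, and \<open>?g (t - 1)\<close> is the first gap before the first round.\<close>
  define I where "I t r' \<longleftrightarrow> r' (q + 11) = (\<Sum>s<t. min (?g (s - 1)) (?g s)) \<and>
     r' (q + 12) = ?g (t - 1) \<and>
     r' (q + 13) = (if \<forall>s<t. fst (?z ! s) < fst (?z ! Suc s) then 1 else 0) \<and>
     digits lo hi m r' \<and> (\<forall>a<q + 9. r' a = r a)" for t r'
  have D: "r' (q + (30 + t)) = real (cand lo hi m ! t)" "inpt xs (cand lo hi m ! t) = ?z ! t"
    if "digits lo hi m r'" "t < Suc (Suc q)" for r' t
    using that cand_less[OF assms(2,3) that(2)] by (simp_all add: digits_def pts_nth inpt_def)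
  have D_Suc: "r' (q + (31 + t)) = real (cand lo hi m ! Suc t)" "inpt xs (cand lo hi m ! Suc t) = ?z ! Suc t"
    if "digits lo hi m r'" "t < Suc q" for r' t
    using D[OF that(1), of "Suc t"] that(2) by simp_all
  have D0: "r' (q + 30) = real (cand lo hi m ! 0)" "r' (q + 31) = real (cand lo hi m ! Suc 0)"
    if "digits lo hi m r'" for r'
    using D(1)[OF that, of 0] D(1)[OF that, of 1] by simp_all
  have keep: "digits lo hi m r' \<Longrightarrow> a < q + 30 \<Longrightarrow> digits lo hi m (r'(a := v))" for r' a v
    by (auto simp: digits_def)
  show ?thesis unfolding evaluate_def
  proof (rule wp_SeqI[where P = "I 0"])
    show "wp (Blk [Const (q + 13) 1, Const (q + 11) 0, DistPow (q + 12) (q + 30) (q + 31)]) r (I 0)"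
      using assms D0[OF assms(1)] D(2)[OF assms(1), of 0] D(2)[OF assms(1), of 1]
      by (simp del: cand_nth add: I_def keep gap_def)
  next
    fix r' assume r': "I 0 r'"
    show "wp (Seq (seqs (map (\<lambda>t.
        Seq (Blk [GetX (q + 9) (q + (30 + t)), GetX (q + 10) (q + (31 + t)),
                  DistPow (q + 14) (q + (30 + t)) (q + (31 + t))])
       (Seq (IfLe (q + 10) (q + 9) (Blk [Const (q + 13) 0]) (Blk []))
       (Seq (IfLe (q + 12) (q + 14) (Blk [Add (q + 11) (q + 11) (q + 12)])
                                    (Blk [Add (q + 11) (q + 11) (q + 14)]))
            (Blk [Copy (q + 12) (q + 14)])))) [0..<Suc q]))
       (Blk [Add (q + 11) (q + 11) (q + 12)])) r'
       (\<lambda>r'. digits lo hi m r' \<and> r' (q + 11) = val (pts lo hi m) \<and>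
     r' (q + 13) = (if chain (pts lo hi m) then 1 else 0) \<and> (\<forall>a<q + 9. r' a = r a))"
    proof (rule wp_SeqI[where P = "I (Suc q)", OF wp_seqs_upt[where I = I, OF r']])
      fix t r' assume t: "t < Suc q" and r': "I t r'"
      then have dig: "digits lo hi m r'" by (simp add: I_def)
      show "wp (Seq (Blk [GetX (q + 9) (q + (30 + t)), GetX (q + 10) (q + (31 + t)),
                  DistPow (q + 14) (q + (30 + t)) (q + (31 + t))])
       (Seq (IfLe (q + 10) (q + 9) (Blk [Const (q + 13) 0]) (Blk []))
       (Seq (IfLe (q + 12) (q + 14) (Blk [Add (q + 11) (q + 11) (q + 12)])
                                    (Blk [Add (q + 11) (q + 11) (q + 14)]))
            (Blk [Copy (q + 12) (q + 14)])))) r' (I (Suc t))"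
        using t r' D[OF dig, of t] D_Suc[OF dig t]
        by (auto simp del: cand_nth simp: I_def keep gap_def less_Suc_eq min_def)
    next
      fix r' assume r': "I (Suc q) r'"
      have "(\<Sum>s<Suc q. min (?g (s - 1)) (?g s)) + ?g q = val ?z"
        by (subst sum.lessThan_Suc_shift) (simp add: val_def tailval_def)
      then show "wp (Blk [Add (q + 11) (q + 11) (q + 12)]) r'
       (\<lambda>r'. digits lo hi m r' \<and> r' (q + 11) = val (pts lo hi m) \<and>
     r' (q + 13) = (if chain (pts lo hi m) then 1 else 0) \<and> (\<forall>a<q + 9. r' a = r a))"
        using r' unfolding I_def chain_Suc by (simp add: keep del: sum.lessThan_Suc)
    qed auto
  qed
qed

definition best :: "nat \<Rightarrow> nat \<Rightarrow> nat \<Rightarrow> regs \<Rightarrow> bool" where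
  "best lo hi m r \<longleftrightarrow> (r 0 = -1 \<and> (\<forall>k<m. \<not> chain (pts lo hi k))) \<or>
     (\<exists>k<m. chain (pts lo hi k) \<and> r 0 = val (pts lo hi k) \<and>
        (\<forall>t<Suc (Suc q). r (Suc t) = real (cand lo hi k ! t)) \<and>
        (\<forall>j<m. chain (pts lo hi j) \<longrightarrow> val (pts lo hi j) \<le> r 0))"

lemma best_cong: "(\<forall>a<q + 3. r' a = r a) \<Longrightarrow> best lo hi m r' = best lo hi m r"
  unfolding best_def by auto

lemma val_nonneg: "0 \<le> val zs"
  by (simp add: val_def tailval_nonneg)

lemma wp_save:
  assumes "digits lo hi m r" "r (q + 11) = val (pts lo hi m)"
    "r (q + 13) = (if chain (pts lo hi m) then 1 else 0)" "base m lo hi r"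
    "r (q + 8) = L" "best lo hi m r"
  shows "wp (save q) r (\<lambda>r'. base (Suc m) lo hi r' \<and> r' (q + 8) = L \<and> best lo hi (Suc m) r')"
proof -
  define P where "P r' \<longleftrightarrow> base m lo hi r' \<and> r' (q + 8) = L \<and> best lo hi (Suc m) r'" for r'
  let ?z = "pts lo hi m"
  have fin: "wp (Blk [Add (q + 7) (q + 7) (q + 4)]) r'
    (\<lambda>r'. base (Suc m) lo hi r' \<and> r' (q + 8) = L \<and> best lo hi (Suc m) r')" if "P r'" for r'
  proof -
    have "best lo hi (Suc m) (r'(q + 7 := x)) = best lo hi (Suc m) r'" for x
      by (rule best_cong) simp
    then show ?thesis using that by (simp add: P_def base_def)
  qed
  have nochain: "P r" if "\<not> chain ?z"
    using assms that unfolding P_def best_def less_Suc_eq by blast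
  \<comment> \<open>Values are nonnegative, so this case excludes the marker \<open>-1\<close> and a
    saved chain exists already.\<close>
  have noimp: "P r" if "val ?z \<le> r 0"
    using assms that val_nonneg[of ?z] unfolding P_def best_def less_Suc_eq by force
  have upd: "wp (seqs (map (\<lambda>t. Blk [Copy (Suc t) (q + (30 + t))]) [0..<Suc (Suc q)])) (r(0 := val ?z)) P"
    if "chain ?z" "\<not> val ?z \<le> r 0"
  proof (rule wp_seqs_upt[where I = "\<lambda>t r'. digits lo hi m r' \<and> r' 0 = val ?z \<and>
      (\<forall>u<t. r' (Suc u) = real (cand lo hi m ! u)) \<and> (\<forall>a. q + 3 \<le> a \<longrightarrow> r' a = r a)"])
    fix r' assume r': "digits lo hi m r' \<and> r' 0 = val ?z \<and>
      (\<forall>u<Suc (Suc q). r' (Suc u) = real (cand lo hi m ! u)) \<and> (\<forall>a. q + 3 \<le> a \<longrightarrow> r' a = r a)"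
    have "val (pts lo hi j) \<le> val ?z" if "j < Suc m" "chain (pts lo hi j)" for j
      using that \<open>\<not> val ?z \<le> r 0\<close> assms(6) unfolding best_def less_Suc_eq by force
    then have "best lo hi (Suc m) r'"
      unfolding best_def using r' \<open>chain ?z\<close> by (intro disjI2 exI[of _ m]) auto
    then show "P r'" using r' assms(4,5) by (simp add: P_def base_def)
  qed (use assms(1) in \<open>auto simp: digits_def less_Suc_eq\<close>)
  show ?thesis unfolding save_def
  proof (rule wp_SeqI[where P = P])
    have "wp (IfLe (q + 11) 0 (Blk []) (Seq (Blk [Copy 0 (q + 11)])
        (seqs (map (\<lambda>t. Blk [Copy (Suc t) (q + (30 + t))]) [0..<Suc (Suc q)])))) r P"
      if "chain ?z"
      using noimp upd that assms(2) by (simp del: upt_Suc)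
    then show "wp (IfLe (q + 4) (q + 13)
      (IfLe (q + 11) 0 (Blk [])
         (Seq (Blk [Copy 0 (q + 11)])
              (seqs (map (\<lambda>t. Blk [Copy (Suc t) (q + (30 + t))]) [0..<Suc (Suc q)]))))
      (Blk [])) r P"
      using nochain assms(3,4) by (simp add: base_def del: upt_Suc)
  qed (fact fin)
qed

lemma cost_blks: "(\<And>t. cost (f t) = c) \<Longrightarrow> cost (seqs (map f l)) = length l * c"
  by (induction l) auto

text \<open>Shows that the counter misses no choice of inner points. The induction adds a leading
  digit as the summand \<open>f u * n ^ u\<close>.\<close>

lemma digits_onto: "(\<And>t. t < u \<Longrightarrow> f t < n) \<Longrightarrow> \<exists>m<n ^ u. \<forall>t<u. m div n ^ t mod n = f t"
proof (induction u)
  case 0 then show ?case by simp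
next
  case (Suc u)
  then obtain m where m: "m < n ^ u" "\<And>t. t < u \<Longrightarrow> m div n ^ t mod n = f t" by auto
  let ?m = "m + f u * n ^ u"
  have "?m div n ^ t mod n = f t" if "t < Suc u" for t
  proof (cases "t = u")
    case True
    have "?m div n ^ u = f u + m div n ^ u"
      using n_pos by (intro div_mult_self1) simp
    then show ?thesis using m(1) Suc.prems[of u] True by simp
  next
    case False
    then have "t < u" using that by simp
    \<comment> \<open>The new summand is a multiple of \<open>n ^ Suc t\<close>, so it is invisible
      in the digit at position \<open>t < u\<close>.\<close>
    then have "f u * n ^ u = (f u * n ^ (u - Suc t) * n) * n ^ t"
      by (simp add: mult.assoc power_add[symmetric] power_Suc[symmetric] del: power_Suc)
    moreover have "(m + (f u * n ^ (u - Suc t) * n) * n ^ t) div n ^ t = f u * n ^ (u - Suc t) * n + m div n ^ t"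
      using n_pos by (intro div_mult_self1) simp
    ultimately have "?m div n ^ t mod n = (f u * n ^ (u - Suc t) * n + m div n ^ t) mod n"
      by (simp only:)
    then show ?thesis using m(2)[OF \<open>t < u\<close>] by simp
  qed
  moreover have "?m < n ^ Suc u"
  proof -
    have "?m < n ^ u + f u * n ^ u" using m(1) by simp
    also have "\<dots> = Suc (f u) * n ^ u" by simp
    also have "\<dots> \<le> n * n ^ u" using Suc.prems[of u] by (intro mult_right_mono) auto
    finally show ?thesis by simp
  qed
  ultimately show ?case by blast
qed

lemma best_correct:
  assumes ext: "extremal n lo hi" and b: "best lo hi (n ^ q) r"
  shows "correct_output \<alpha> xs (Suc (Suc q)) r"
proof -
  let ?E = "set xs"
  have E: "front ?E" using pareto by (rule front_set)
  have lo: "lo < n" "hi < n" using ext by (auto simp: extremal_def)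
  \<comment> \<open>Moving the ends of \<open>ys\<close> to the extremes loses nothing, and the
    inner indices are the digits of some \<open>k\<close>.\<close>
  have dominated: "\<exists>k<n ^ q. chain (pts lo hi k) \<and> val ys \<le> val (pts lo hi k)"
    if ys: "chain ys" "set ys \<subseteq> ?E" "length ys = Suc (Suc q)" for ys
  proof -
    have "\<exists>i<n. ys ! Suc t = xs ! i" if "t < q" for t
      using ys that by (metis in_set_conv_nth nth_mem subsetD Suc_mono less_SucI)
    then obtain f where f: "\<And>t. t < q \<Longrightarrow> f t < n \<and> ys ! Suc t = xs ! f t" by metis
    then obtain k where k: "k < n ^ q" "\<And>t. t < q \<Longrightarrow> k div n ^ t mod n = f t"
      using digits_onto[of q f] by blast
    have eq: "ys[0 := xs ! lo, Suc q := xs ! hi] = pts lo hi k"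
    proof (rule nth_equalityI)
      fix i assume "i < length (ys[0 := xs ! lo, Suc q := xs ! hi])"
      then have "i < Suc (Suc q)" using ys(3) by simp
      then show "ys[0 := xs ! lo, Suc q := xs ! hi] ! i = pts lo hi k ! i"
        by (rule position_cases[rotated -1]) (use ys(3) f k in \<open>auto simp: nth_list_update pts_nth\<close>)
    qed (use ys in simp)
    have "\<And>z. z \<in> ?E \<Longrightarrow> fst (xs ! lo) \<le> fst z" "\<And>z. z \<in> ?E \<Longrightarrow> fst z \<le> fst (xs ! hi)"
      using ext by (auto simp: extremal_def in_set_conv_nth)
    from extend_to_extremes[OF E ys alpha _ this(1) _ this(2)] lo show ?thesis
      unfolding eq val_def using k(1) by auto
  qed
  \<comment> \<open>Sorting any \<open>q + 2\<close> input points gives one chain, so the search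
    cannot end with the marker \<open>-1\<close>.\<close>
  have "\<exists>ys. chain ys \<and> set ys \<subseteq> ?E \<and> length ys = Suc (Suc q)"
  proof -
    have "distinct xs"
      using pareto unfolding pareto_front_def distinct_conv_nth incomp_def prec_def by (metis less_irrefl)
    then have "distinct (take (Suc (Suc q)) xs)" by simp
    from ex_chain[OF E this set_take_subset, of \<alpha>] len show ?thesis
      by (metis length_take min.absorb2 set_take_subset)
  qed
  then obtain k0 where "k0 < n ^ q" "chain (pts lo hi k0)" using dominated by blast
  then obtain k where k: "k < n ^ q" "chain (pts lo hi k)" "r 0 = val (pts lo hi k)"
    "\<And>t. t < Suc (Suc q) \<Longrightarrow> r (Suc t) = real (cand lo hi k ! t)"
    "\<And>j. j < n ^ q \<Longrightarrow> chain (pts lo hi j) \<Longrightarrow> val (pts lo hi j) \<le> r 0"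
    using b unfolding best_def by blast
  have ks_less: "\<forall>i\<in>set (cand lo hi k). i < n"
    using cand_less[OF lo] by (auto simp: in_set_conv_nth simp del: cand_nth)
  then have sub: "set (pts lo hi k) \<subseteq> ?E" by (auto simp: pts_def)
  have opt: "pts lo hi k \<in> tuples (Suc (Suc q)) ?E"
    "dispersion \<alpha> (pts lo hi k) = opt_value \<alpha> (Suc (Suc q)) ?E"
    "opt_value \<alpha> (Suc (Suc q)) ?E = val (pts lo hi k)"
    unfolding val_def
    by (rule opt_valueI[OF E _ _ k(2) sub alpha, unfolded length_pts], simp, simp,
        use dominated k(3,5) in \<open>fastforce simp: val_def\<close>)+
  have ks: "map (\<lambda>i. idx (r (Suc i))) [0..<Suc (Suc q)] = cand lo hi k"
    by (rule nth_equalityI) (auto simp: k(4) simp del: cand_nth upt_Suc)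
  show ?thesis
    unfolding correct_output_def ks Let_def
    using opt k(3) ks_less by (simp add: pts_def)
qed

text \<open>The summand \<open>n\<close> pays for the search for the extremes, which exceeds
  \<open>n ^ q\<close> when \<open>q = 0\<close>.\<close>

theorem brute_force_solves:
  "solves_within (comp 0 (brute_force q)) \<alpha> xs (Suc (Suc q))
     ((18 * q + 60) * real (n + n ^ q)) (2 * q + 40)"
proof (rule solves_withinI)
  have "ok (brute_force q) (\<lambda>_. 0) ((n * 12 + 6) + ((q + 3) + (n ^ q * ((16 * q + 35) + 2) + 1)))
     (correct_output \<alpha> xs (Suc (Suc q)))"
    unfolding brute_force_def
  proof (intro ok_SeqI[OF ok_extremes])
    fix r assume "\<exists>m lo hi. base m lo hi r \<and> extremal n lo hi"
    then obtain m0 lo hi where r: "base m0 lo hi r" and ext: "extremal n lo hi" by blast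
    then have lo: "lo < n" "hi < n" by (auto simp: extremal_def)
    let ?I = "\<lambda>m r. base m lo hi r \<and> r (q + 8) = real (n ^ q) \<and> best lo hi m r"
    have body: "wp (Seq (decode q) (Seq (evaluate q) (save q))) r (?I (Suc m))" if I: "?I m r" for m r
    proof (rule wp_SeqI[OF wp_decode[of m lo hi]])
      fix r1 assume r1: "digits lo hi m r1 \<and> (\<forall>a<q + 9. r1 a = r a)"
      show "wp (Seq (evaluate q) (save q)) r1 (?I (Suc m))"
      proof (rule wp_SeqI[OF wp_evaluate[OF _ lo]])
        fix r2 assume r2: "digits lo hi m r2 \<and> r2 (q + 11) = val (pts lo hi m) \<and>
           r2 (q + 13) = (if chain (pts lo hi m) then 1 else 0) \<and> (\<forall>a<q + 9. r2 a = r1 a)"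
        then have "best lo hi m r2 = best lo hi m r"
          using r1 by (intro best_cong) auto
        then show "wp (save q) r2 (?I (Suc m))"
          using r1 r2 I by (intro wp_save[where m = m]) (auto simp: base_def)
      qed (use r1 in auto)
    qed (use I in auto)
    show "ok (Seq (power_loop q) (WhileLt (q + 7) (q + 8) (Seq (decode q) (Seq (evaluate q) (save q)))))
       r ((q + 3) + (n ^ q * ((16 * q + 35) + 2) + 1)) (correct_output \<alpha> xs (Suc (Suc q)))"
    proof (rule ok_SeqI[where P = "?I 0", OF ok_wpI])
      show "wp (power_loop q) r (?I 0)"
        unfolding power_loop_def
      proof (rule wp_SeqI[where P = "\<lambda>r'. base m0 lo hi r' \<and> r' (q + 8) = 1"])
        fix r' assume r': "base m0 lo hi r' \<and> r' (q + 8) = 1"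
        show "wp (Seq (seqs (map (\<lambda>t. Blk [Mul (q + 8) (q + 8) (q + 3)]) [0..<q]))
          (Blk [Const 0 (-1), Const (q + 7) 0])) r' (?I 0)"
          by (rule wp_SeqI[OF wp_seqs_upt[where I = "\<lambda>t r'. base m0 lo hi r' \<and> r' (q + 8) = real (n ^ t)"
                and Q = "\<lambda>r'. base m0 lo hi r' \<and> r' (q + 8) = real (n ^ q)"]])
             (use r' in \<open>auto simp: base_def best_def\<close>)
      qed (use r in \<open>auto simp: base_def\<close>)
      show "cost (power_loop q) \<le> q + 3"
        by (simp add: power_loop_def cost_blks)
    next
      fix r assume r: "?I 0 r"
      show "ok (WhileLt (q + 7) (q + 8) (Seq (decode q) (Seq (evaluate q) (save q)))) r
        (n ^ q * ((16 * q + 35) + 2) + 1) (correct_output \<alpha> xs (Suc (Suc q)))"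
      proof (rule ok_WhileLt[where I = ?I], simp, simp, intro conjI ok_wpI)
        fix m r assume "m < n ^ q" "?I m r"
        then show "r (q + 7) < r (q + 8)" by (simp add: base_def del: of_nat_power)
      next
        fix m r assume "?I m r"
        then show "wp (Seq (decode q) (Seq (evaluate q) (save q))) r (?I (Suc m))" by (rule body)
      next
        show "cost (Seq (decode q) (Seq (evaluate q) (save q))) \<le> 16 * q + 35"
          by (simp add: decode_def evaluate_def save_def cost_blks del: upt_Suc)
      qed (use r best_correct[OF ext] in \<open>auto simp: base_def\<close>)
    qed simp
  qed simp
  then show "ok (brute_force q) (\<lambda>_. 0) (18 * q * (n + n ^ q) + 60 * (n + n ^ q))
     (correct_output \<alpha> xs (Suc (Suc q)))"
  proof (rule ok_mono)
    have "q * 1 \<le> q * (n + n ^ q)" using n_pos by (intro mult_le_mono2) linarith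
    then show "n * 12 + 6 + (q + 3 + (n ^ q * (16 * q + 35 + 2) + 1))
       \<le> 18 * q * (n + n ^ q) + 60 * (n + n ^ q)"
      using n_pos by (simp only: algebra_simps)
  qed
qed (simp_all add: algebra_simps)

end

text \<open>The exponent \<open>max 1 q\<close> absorbs the linear scan: \<open>n + n ^ q\<close> is
  at most twice \<open>n ^ max 1 q\<close>, which doubles the constants.\<close>

lemma brute_solves:
  assumes "0 < \<alpha>"
  shows "\<exists>prog (c::real). \<forall>xs. valid_instance xs (Suc (Suc q)) \<longrightarrow>
     solves_within prog \<alpha> xs (Suc (Suc q)) (c * real (length xs) ^ max 1 q) c"
proof (intro exI[of _ "comp 0 (brute_force q)"] exI[of _ "36 * real q + 120"] allI impI)
  fix xs assume "valid_instance xs (Suc (Suc q))"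
  then interpret brute \<alpha> xs q
    using assms by unfold_locales (auto simp: valid_instance_def)
  have n: "1 \<le> n" using n_pos by linarith
  have "n ^ 1 \<le> n ^ max 1 q" "n ^ q \<le> n ^ max 1 q"
    using n by (intro power_increasing; simp)+
  then have "n + n ^ q \<le> 2 * n ^ max 1 q" by simp
  then have "real (n + n ^ q) \<le> 2 * real n ^ max 1 q"
    by (metis of_nat_le_iff of_nat_mult of_nat_numeral of_nat_power)
  then have "(18 * q + 60) * real (n + n ^ q) \<le> (18 * q + 60) * (2 * real n ^ max 1 q)"
    by (intro mult_left_mono) simp_all
  then show "solves_within (comp 0 (brute_force q)) \<alpha> xs (Suc (Suc q))
     ((36 * real q + 120) * real n ^ max 1 q) (36 * real q + 120)"
    by (intro solves_within_mono[OF brute_force_solves]) (simp_all add: algebra_simps)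
qed

section \<open>Dynamic programming\<close>

text \<open>Registers of the dynamic program: 0 holds the address of the output buffer (value first, then
  selection), 1 and 2 hold \<open>n\<close> and \<open>p\<close>, 3 and 4 the constants 1 and 0, 5 and 6 the
  addresses of the value table and of the link table, 7 the number of the current table entry, 8 the
  number of entries, 9 the first entry of the last layer, 10 and 11 the best total value and the entry
  attaining it.  Registers 12 to 24 are temporary: 12, 13, 14 are the indices \<open>i\<close>, \<open>j\<close>, \<open>k\<close> of
  the entry number \<open>(k * n + i) * n + j\<close>.\<close>

definition init_dp :: cmd where
  "init_dp = Blk [GetN 1, GetP 2, Const 3 1, Const 4 0, Const 0 32, Add 0 0 2,
     Add 5 0 2, Add 5 5 3, Sub 8 2 3, Mul 8 8 1, Mul 8 8 1, Mul 16 1 1, Sub 9 8 16,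
     Add 6 5 8, Const 7 0, Const 10 (-1), Const 11 0]"

definition scan_step :: cmd where
  "scan_step = Seq (Blk [Add 16 5 20, LoadInd 22 16])
     (Seq (IfLe 4 22
         (Seq (Blk [DistPow 16 21 12])
         (Seq (IfLe 16 19 (Blk [Add 22 22 16]) (Blk [Add 22 22 19]))
              (IfLe 22 17 (Blk []) (Blk [Copy 17 22, Copy 18 20]))))
         (Blk []))
       (Blk [Add 21 21 3, Add 20 20 1]))"

text \<open>Register 20 runs through the numbers of the entries \<open>(k, h, i)\<close> of the
  previous layer; raising \<open>h\<close> by one raises the number by \<open>n\<close>.\<close>

definition scan_loop :: cmd where
  "scan_loop = Seq (Blk [Sub 20 14 3, Mul 20 20 1, Mul 20 20 1, Add 20 20 12, Const 21 0])
     (WhileLt 21 1 scan_step)"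

definition decode_cell :: cmd where
  "decode_cell = Blk [Divide 15 7 1, Floor 15 15, Mul 16 15 1, Sub 13 7 16,
     Divide 14 15 1, Floor 14 14, Mul 16 14 1, Sub 12 15 16,
     Const 17 (-1), Const 18 0, GetX 23 12, GetX 24 13]"

definition compute_cell :: cmd where
  "compute_cell = Seq decode_cell
     (IfLe 23 24 (Blk [])
        (Seq (Blk [DistPow 19 12 13])
             (IfLe 3 14 scan_loop (Blk [Copy 17 19, Copy 18 12]))))"

text \<open>Only the last layer describes chains of full length. Adding register 19, the first gap,
  supplies the missing term of the first point.\<close>

definition store_cell :: cmd where
  "store_cell = Seq (Blk [Add 16 5 7, StoreInd 16 17, Add 16 6 7, StoreInd 16 18])
     (Seq (IfLe 9 7
         (IfLe 4 17
            (Seq (Blk [Add 17 17 19]) (IfLe 17 10 (Blk []) (Blk [Copy 10 17, Copy 11 7])))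
            (Blk []))
         (Blk []))
       (Blk [Add 7 7 3]))"

definition backtrack :: cmd where
  "backtrack = Seq (Blk [Copy 12 11, Const 21 0])
     (WhileLt 21 2 (Blk [Divide 15 12 1, Floor 15 15, Mul 15 15 1, Sub 13 12 15,
        Add 16 0 21, Add 16 16 3, StoreInd 16 13, Add 16 6 12, LoadInd 12 16, Add 21 21 3]))"

text \<open>Output registers from 32 on are filled while the working registers are still available;
  the loop is empty if \<open>p < 32\<close>.\<close>

definition move_high :: cmd where
  "move_high = Seq (Blk [StoreInd 0 10, Const 21 32, Add 2 2 3])
     (WhileLt 21 2 (Blk [Add 16 0 21, LoadInd 22 16, StoreInd 21 22, Add 21 21 3]))"

text \<open>The scratch registers themselves belong to the output area, so each of them is first loaded
  with the address of its final content.\<close>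

definition move_low :: cmd where
  "move_low = Seq
     (seqs (map (\<lambda>i. Blk [Const i (real i), Add i i 0, LoadInd i i]) [1..<32]))
     (Blk [LoadInd 0 0])"

definition dynamic_program :: cmd where
  "dynamic_program = Seq init_dp (Seq (WhileLt 7 8 (Seq compute_cell store_cell))
     (Seq backtrack (Seq move_high move_low)))"

locale dp = ram +
  assumes mem: "mem = 100 + 2 * p + 2 * ((p - 1) * length xs * length xs)"
    and pareto: "pareto_front xs" and p2: "2 \<le> p" and len: "p \<le> length xs" and alpha: "0 < \<alpha>"
begin

abbreviation "n \<equiv> length xs"
definition "cells = (p - 1) * n * n"
definition "layer_start = (p - 2) * n * n"
text \<open>The buffer starts above both the working registers and the final output area
  \<open>0..p\<close>, so moving the result never overwrites an entry still to be read.\<close>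

definition "out = 32 + p"
definition "vals = 33 + 2 * p"
definition "links = 33 + 2 * p + cells"

lemma layout:
  "32 \<le> out" "p < out" "out + p < vals" "vals + cells \<le> links"
  "links + cells + 64 \<le> mem" "out + 64 \<le> mem" "out + p + 1 < mem"
  by (simp_all add: out_def vals_def links_def mem cells_def)

lemma data_ge [simp]: "32 \<le> vals + a" "32 \<le> links + a"
  by (simp_all add: vals_def links_def)

lemma data_neq [simp]:
  "c < 32 \<Longrightarrow> vals + a \<noteq> c" "c < 32 \<Longrightarrow> c \<noteq> vals + a"
  "vals \<noteq> 0" "links \<noteq> 0" "c < 32 \<Longrightarrow> links + a \<noteq> c" "c < 32 \<Longrightarrow> c \<noteq> links + a"
  "a < cells \<Longrightarrow> vals + a \<noteq> links + b" "a < cells \<Longrightarrow> links + b \<noteq> vals + a"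
  by (simp_all add: vals_def links_def)

lemma small_less_mem [simp]: "a < 64 \<Longrightarrow> a < mem"
  using layout(6) by linarith

lemma n_pos: "0 < n" using p2 len by linarith

section \<open>The recursion over the third point\<close>

definition w :: "nat \<Rightarrow> nat \<Rightarrow> real" where
  "w i j = dist (xs ! i) (xs ! j) powr \<alpha>"

lemma w_commute: "w i j = w j i"
  by (simp add: w_def dist_commute)

lemma w_nonneg [simp]: "0 \<le> w i j"
  by (simp add: w_def)

text \<open>A running maximum over the third point \<open>h\<close>, recursive in the bound so that
  it is literally the loop invariant. For \<open>g = table k\<close> the order condition on
  \<open>h\<close> is contained in the sign of \<open>g h i\<close>.\<close>

primrec scan :: "(nat \<Rightarrow> nat \<Rightarrow> real \<times> nat) \<Rightarrow> nat \<Rightarrow> nat \<Rightarrow> nat \<Rightarrow> nat \<Rightarrow> real \<times> nat" where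
  "scan g k i j 0 = (-1, 0)"
| "scan g k i j (Suc h) =
     (if 0 \<le> fst (g h i) \<and> fst (scan g k i j h) < fst (g h i) + min (w h i) (w i j)
      then (fst (g h i) + min (w h i) (w i j), (k * n + h) * n + i) else scan g k i j h)"

text \<open>The first component of \<open>table k i j\<close> is the largest \<open>tailval\<close> of an increasing chain of
  \<open>k + 2\<close> points that starts with the points number \<open>j\<close> and \<open>i\<close>, or \<open>-1\<close> if there is no such
  chain.  The second component is the number of the entry for the chain without its first point;
  for \<open>k = 0\<close> it is \<open>i\<close>, so that following these links and reducing modulo \<open>n\<close> yields the chain.\<close>

primrec table :: "nat \<Rightarrow> nat \<Rightarrow> nat \<Rightarrow> real \<times> nat" where
  "table 0 = (\<lambda>i j. if fst (xs ! j) < fst (xs ! i) then (w i j, i) else (-1, 0))"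
| "table (Suc k) =
     (\<lambda>i j. if fst (xs ! j) < fst (xs ! i) then scan (table k) k i j n else (-1, 0))"

definition cell :: "nat \<Rightarrow> real \<times> nat" where
  "cell m = table (m div n div n) (m div n mod n) (m mod n)"

definition link :: "nat \<Rightarrow> nat" where "link m = snd (cell m)"

definition trace :: "nat \<Rightarrow> nat \<Rightarrow> nat list" where
  "trace l m = map (\<lambda>t. (link ^^ t) m mod n) [0..<l]"

lemma cell_eq: "i < n \<Longrightarrow> j < n \<Longrightarrow> cell ((k * n + i) * n + j) = table k i j"
  using n_pos by (simp add: cell_def)

lemma scan_sound:
  "0 \<le> fst (scan g k i j h) \<Longrightarrow> \<exists>h'<h. 0 \<le> fst (g h' i) \<and>
     scan g k i j h = (fst (g h' i) + min (w h' i) (w i j), (k * n + h') * n + i)"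
  by (induction h) (auto split: if_splits intro: less_SucI)

lemma scan_complete:
  "h' < h \<Longrightarrow> 0 \<le> fst (g h' i) \<Longrightarrow> fst (g h' i) + min (w h' i) (w i j) \<le> fst (scan g k i j h)"
  by (induction h) (auto simp: less_Suc_eq)

lemma scan_link: "snd (scan g k i j h) \<le> (k * n + h) * n + i"
  by (induction h) (auto simp: algebra_simps)

text \<open>Keeps backtracking inside the table. The bound holds for every number, which also covers
  the one surplus link that the loop reads after the last point.\<close>

lemma link_le: "link m \<le> m"
proof -
  let ?i = "m div n mod n" and ?j = "m mod n"
  have i: "?i \<le> m" by (meson div_le_dividend mod_less_eq_dividend order_trans)
  have j: "?i < n" using n_pos by simp
  show ?thesis
  proof (cases "m div n div n")
    case 0 then show ?thesis using i by (simp add: link_def cell_def)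
  next
    case (Suc k)
    have "snd (scan (table k) k ?i ?j n) \<le> (k * n + n) * n + ?i" by (rule scan_link)
    also have "(k * n + n) * n + ?i \<le> (m div n div n * n) * n + ?i * n"
    proof -
      have "?i * 1 \<le> ?i * n" using n_pos by (intro mult_le_mono2) linarith
      then show ?thesis using Suc by (simp add: algebra_simps)
    qed
    also have "\<dots> = m div n * n"
      by (metis add_mult_distrib div_mult_mod_eq)
    also have "\<dots> \<le> m" by simp
    finally show ?thesis using Suc by (simp add: link_def cell_def)
  qed
qed

lemma link_pow_le: "(link ^^ t) m \<le> m"
  by (induction t) (auto intro: order_trans[OF link_le])

lemma chain_Cons2: "chain (a # b # zs) \<longleftrightarrow> fst a < fst b \<and> chain (b # zs)"
  by (auto simp: chain_def)

lemma trace_Suc: "trace (Suc l) m = m mod n # trace l (link m)"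
  by (simp add: trace_def map_upt_Suc funpow_Suc_right del: upt_Suc funpow.simps)

text \<open>A nonnegative entry owes its value to some third point whose entry is nonnegative too,
  and the link leads to exactly that entry; induction on the layer reconstructs the chain.\<close>

lemma table_sound:
  "i < n \<Longrightarrow> j < n \<Longrightarrow> 0 \<le> fst (table k i j) \<Longrightarrow>
   \<exists>l. trace (Suc (Suc k)) ((k * n + i) * n + j) = j # i # l \<and> chain (map ((!) xs) (j # i # l)) \<and>
     tailval \<alpha> (map ((!) xs) (j # i # l)) = fst (table k i j)"
proof (induction k arbitrary: i j)
  case 0
  then have "fst (xs ! j) < fst (xs ! i)" by (auto split: if_splits)
  \<comment> \<open>In the bottom layer the link is the index \<open>i\<close> itself; as
    \<open>i < n\<close>, reducing it modulo \<open>n\<close> yields the last point.\<close>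
  moreover have "link (i * n + j) = i"
    using cell_eq[of i j 0] 0 calculation by (simp add: link_def)
  ultimately show ?case
    using 0 by (simp add: trace_Suc chain_Cons2 tailval_two w_commute)
      (simp add: trace_def chain_def w_def tailval_two dist_commute)
next
  case (Suc k)
  then have lt: "fst (xs ! j) < fst (xs ! i)" by (auto split: if_splits)
  then have "0 \<le> fst (scan (table k) k i j n)" using Suc.prems by simp
  from scan_sound[OF this] obtain h where h: "h < n" "0 \<le> fst (table k h i)"
    "table (Suc k) i j = (fst (table k h i) + min (w h i) (w i j), (k * n + h) * n + i)"
    using lt by auto
  from Suc.IH[OF h(1) Suc.prems(1) h(2)] obtain l where l:
    "trace (Suc (Suc k)) ((k * n + h) * n + i) = i # h # l" "chain (map ((!) xs) (i # h # l))"
    "tailval \<alpha> (map ((!) xs) (i # h # l)) = fst (table k h i)" by blast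
  have "link ((Suc k * n + i) * n + j) = (k * n + h) * n + i"
    using cell_eq[OF Suc.prems(1,2), of "Suc k"] h(3) by (simp only: link_def snd_conv)
  then have "trace (Suc (Suc (Suc k))) ((Suc k * n + i) * n + j) = j # i # h # l"
    using l(1) Suc.prems(2) by (subst trace_Suc) simp
  moreover have "tailval \<alpha> (map ((!) xs) (j # i # h # l)) = fst (table (Suc k) i j)"
    using l(3) h(3) by (simp add: tailval_Cons w_def dist_commute del: table.simps)
  ultimately show ?case
    using l(2) lt by (intro exI[of _ "h # l"]) (simp add: chain_Cons2 del: table.simps)
qed

text \<open>The third point of the chain is among those that the scan compares, and the increment by
  \<open>tailval_Cons\<close> is the one used there.\<close>

lemma table_complete:
  "\<forall>a\<in>set (j # i # l). a < n \<Longrightarrow> chain (map ((!) xs) (j # i # l)) \<Longrightarrow>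
   tailval \<alpha> (map ((!) xs) (j # i # l)) \<le> fst (table (length l) i j)"
proof (induction l arbitrary: i j)
  case Nil
  then show ?case by (simp add: chain_Cons2 tailval_two w_def dist_commute)
next
  case (Cons h l)
  then have lt: "fst (xs ! j) < fst (xs ! i)" by (simp add: chain_Cons2)
  have IH: "tailval \<alpha> (map ((!) xs) (i # h # l)) \<le> fst (table (length l) h i)"
    by (rule Cons.IH) (use Cons.prems in \<open>auto simp: chain_Cons2\<close>)
  \<comment> \<open>The scan skips negative entries, so the entry for the rest of the chain must be
    shown to be genuine.\<close>
  then have "0 \<le> fst (table (length l) h i)" using tailval_nonneg order_trans by blast
  from scan_complete[of h n "table (length l)", OF _ this] Cons.prems(1)
  have "fst (table (length l) h i) + min (w h i) (w i j) \<le> fst (table (length (h # l)) i j)"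
    using lt by simp
  then show ?case using IH by (simp add: tailval_Cons w_def dist_commute del: table.simps)
qed

section \<open>Filling the table on the machine\<close>

definition base :: "regs \<Rightarrow> bool" where
  "base r \<longleftrightarrow> r 0 = real out \<and> r 1 = real n \<and> r 2 = real p \<and> r 3 = 1 \<and> r 4 = 0 \<and>
     r 5 = real vals \<and> r 6 = real links \<and> r 8 = real cells \<and> r 9 = real layer_start"

definition filled :: "nat \<Rightarrow> regs \<Rightarrow> bool" where
  "filled m r \<longleftrightarrow> (\<forall>a<m. r (vals + a) = fst (cell a) \<and>
     r (links + a) = real (link a))"

text \<open>The first gap of the chains described by an entry: what \<open>tailval\<close> lacks to
  the full objective.\<close>

definition weight :: "nat \<Rightarrow> real" where
  "weight m = w (m div n mod n) (m mod n)"

lemma weight_eq: "i < n \<Longrightarrow> j < n \<Longrightarrow> weight ((k * n + i) * n + j) = w i j"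
  using n_pos by (simp add: weight_def)

definition final_best :: "nat \<Rightarrow> regs \<Rightarrow> bool" where
  "final_best m r \<longleftrightarrow>
     (r 10 = -1 \<and> (\<forall>a<m. layer_start \<le> a \<longrightarrow> fst (cell a) < 0)) \<or>
     (\<exists>a<m. layer_start \<le> a \<and> 0 \<le> fst (cell a) \<and> r 11 = real a \<and> r 10 = fst (cell a) + weight a \<and>
        (\<forall>b<m. layer_start \<le> b \<longrightarrow> 0 \<le> fst (cell b) \<longrightarrow> fst (cell b) + weight b \<le> r 10))"

lemma wp_init: "wp init_dp r (\<lambda>r'. base r' \<and> r' 7 = 0 \<and> final_best 0 r')"
proof -
  have c: "(real p - 1) * real n * real n = real cells"
    using p2 by (simp add: cells_def of_nat_diff)
  have l: "real cells - real n * real n = real layer_start"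
    using p2 by (simp add: cells_def layer_start_def of_nat_diff algebra_simps)
  have o: "32 + real p = real out" "real out + real p + 1 = real vals"
    "real vals + real cells = real links"
    by (simp_all add: out_def vals_def links_def)
  show ?thesis
    by (simp add: init_dp_def base_def final_best_def c l o)
qed

lemma ok_scan:
  assumes r: "base r" "filled m r" "m < cells" "m div n div n = Suc k"
    "r 12 = real i" "i < n" "r 14 = real (Suc k)" "r 17 = -1" "r 18 = 0" "r 19 = w i j"
  shows "ok scan_loop r (22 * n + 6) (\<lambda>r'. r' 17 = fst (scan (table k) k i j n) \<and>
     r' 18 = real (snd (scan (table k) k i j n)) \<and> r' 19 = w i j \<and>
     (\<forall>a. a < 12 \<or> 32 \<le> a \<longrightarrow> r' a = r a))"
proof -
  define I where "I h r' \<longleftrightarrow> r' 17 = fst (scan (table k) k i j h) \<and>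
     r' 18 = real (snd (scan (table k) k i j h)) \<and> r' 19 = w i j \<and> r' 12 = real i \<and>
     r' 20 = real ((k * n + h) * n + i) \<and> r' 21 = real h \<and>
     (\<forall>a. a < 12 \<or> 32 \<le> a \<longrightarrow> r' a = r a)" for h r'
  \<comment> \<open>The entries read belong to the preceding layer and hence are filled
    already.\<close>
  have below: "(k * n + h) * n + i < m" if "h < n" for h
  proof -
    have "(k * n + h) * n + i < (k * n + h) * n + n" using r(6) by simp
    also have "\<dots> = (k * n + Suc h) * n" by simp
    also have "\<dots> \<le> Suc k * n * n" using that by (intro mult_right_mono) auto
    also have "\<dots> \<le> m div n * n"
      using r(4) by (metis div_times_less_eq_dividend mult_le_mono1)
    also have "\<dots> \<le> m" by simp
    finally show ?thesis .
  qed
  show ?thesis unfolding scan_loop_def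
  proof (rule ok_SeqI[where P = "I 0", OF ok_wpI[OF _ order_refl]])
    show "wp (Blk [Sub 20 14 3, Mul 20 20 1, Mul 20 20 1, Add 20 20 12, Const 21 0]) r (I 0)"
      using r by (simp add: I_def base_def)
  next
    fix r' assume "I 0 r'"
    show "ok (WhileLt 21 1 scan_step) r' (n * (20 + 2) + 1)
      (\<lambda>r'. r' 17 = fst (scan (table k) k i j n) \<and>
       r' 18 = real (snd (scan (table k) k i j n)) \<and> r' 19 = w i j \<and>
       (\<forall>a. a < 12 \<or> 32 \<le> a \<longrightarrow> r' a = r a))"
    proof (rule ok_WhileLt[where I = I])
      fix h r' assume h: "h < n" and I: "I h r'"
      have r': "r' 1 = real n" "r' 3 = 1" "r' 4 = 0" "r' 5 = real vals"
        using I r(1) by (auto simp: I_def base_def)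
      have "r' (vals + ((k * n + h) * n + i)) = fst (table k h i)"
        using below[OF h] r(2) I cell_eq[OF h r(6)] by (simp add: I_def filled_def)
      moreover have "vals + ((k * n + h) * n + i) < mem"
        using below[OF h] r(3) layout by linarith
      moreover have "inpt xs h = xs ! h" "inpt xs i = xs ! i" using h r(6) by (simp_all add: inpt_def)
      moreover have "idx (r' 5 + r' 20) = vals + ((k * n + h) * n + i)"
        using I r' by (simp only: I_def idx_add)
      moreover have "r' 20 + r' 1 = real ((k * n + Suc h) * n + i)"
        using I r' by (simp add: I_def algebra_simps)
      ultimately have "wp scan_step r' (I (Suc h))"
        using I r'(2,3) unfolding scan_step_def I_def
        by (auto simp: w_def[symmetric] min_def simp del: of_nat_add of_nat_mult)
      then have "ok scan_step r' 20 (I (Suc h))"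
        by (rule ok_wpI) (simp add: scan_step_def)
      then show "r' 21 < r' 1 \<and> ok scan_step r' 20 (I (Suc h))"
        using h I r' by (simp add: I_def)
    next
      fix r' assume "I n r'"
      then show "\<not> r' 21 < r' 1 \<and> r' 17 = fst (scan (table k) k i j n) \<and>
       r' 18 = real (snd (scan (table k) k i j n)) \<and> r' 19 = w i j \<and>
       (\<forall>a. a < 12 \<or> 32 \<le> a \<longrightarrow> r' a = r a)"
        using r(1) by (simp add: I_def base_def)
    qed (use \<open>I 0 r'\<close> in simp_all)
  qed simp
qed

text \<open>The clause on register 19 is conditional because the gap is computed only after the
  order test has succeeded, which a nonnegative entry implies.\<close>

lemma ok_compute_cell:
  assumes r: "base r" "filled m r" "m < cells" "r 7 = real m"
  shows "ok compute_cell r (22 * n + 25) (\<lambda>r'. r' 17 = fst (cell m) \<and> r' 18 = real (link m) \<and>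
     (0 \<le> fst (cell m) \<longrightarrow> r' 19 = weight m) \<and> (\<forall>a. a < 12 \<or> 32 \<le> a \<longrightarrow> r' a = r a))"
proof -
  let ?i = "m div n mod n" and ?j = "m mod n" and ?k = "m div n div n"
  have ij: "?i < n" "?j < n" using n_pos by simp_all
  let ?P = "\<lambda>r'. r' 12 = real ?i \<and> r' 13 = real ?j \<and> r' 14 = real ?k \<and> r' 17 = -1 \<and> r' 18 = 0 \<and>
     r' 23 = fst (xs ! ?i) \<and> r' 24 = fst (xs ! ?j) \<and> (\<forall>a. a < 12 \<or> 32 \<le> a \<longrightarrow> r' a = r a)"
  show ?thesis unfolding compute_cell_def
  proof (rule ok_SeqI[where P = ?P, OF ok_wpI[OF _ order_refl]])
    show "wp decode_cell r ?P"
      using r ij by (simp add: decode_cell_def base_def floor_div_nat real_mod inpt_def)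
  next
    let ?Q = "\<lambda>r'. r' 17 = fst (cell m) \<and> r' 18 = real (link m) \<and>
     (0 \<le> fst (cell m) \<longrightarrow> r' 19 = weight m) \<and> (\<forall>a. a < 12 \<or> 32 \<le> a \<longrightarrow> r' a = r a)"
    fix s assume s: "?P s"
    show "ok (IfLe 23 24 (Blk []) (Seq (Blk [DistPow 19 12 13])
             (IfLe 3 14 scan_loop (Blk [Copy 17 19, Copy 18 12])))) s
        (2 + (1 + (2 + (22 * n + 6)))) ?Q"
    proof (rule ok_IfLe)
      assume "s 23 \<le> s 24"
      \<comment> \<open>The order is violated, and the defaults set by \<open>decode_cell\<close>
        are already the entry.\<close>
      then have "cell m = (-1, 0)" using s by (cases ?k) (auto simp: cell_def)
      then show "ok (Blk []) s (1 + (2 + (22 * n + 6))) ?Q"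
        using s by (intro ok_wpI) (simp_all add: link_def)
    next
      assume "\<not> s 23 \<le> s 24"
      then have lt: "fst (xs ! ?j) < fst (xs ! ?i)" using s by simp
      let ?R = "\<lambda>r'. ?P r' \<and> r' 19 = w ?i ?j"
      show "ok (Seq (Blk [DistPow 19 12 13])
             (IfLe 3 14 scan_loop (Blk [Copy 17 19, Copy 18 12]))) s (1 + (2 + (22 * n + 6))) ?Q"
      proof (rule ok_SeqI[where P = ?R, OF ok_wpI[OF _ order_refl]])
        show "wp (Blk [DistPow 19 12 13]) s ?R"
          using s ij by (simp add: inpt_def w_def)
      next
        fix u assume u: "?R u"
        have u3: "u 3 = 1" using u r(1) by (simp add: base_def)
        show "ok (IfLe 3 14 scan_loop (Blk [Copy 17 19, Copy 18 12])) u (2 + (22 * n + 6)) ?Q"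
        proof (rule ok_IfLe)
          assume "u 3 \<le> u 14"
          then obtain k where k: "?k = Suc k" using u u3 by (cases ?k) auto
          have c: "cell m = scan (table k) k ?i ?j n" using lt k by (simp add: cell_def)
          have "base u" "filled m u"
            using r(1,2) u by (simp_all add: base_def filled_def)
          from ok_scan[OF this r(3) k _ ij(1), of ?j]
          have "ok scan_loop u (22 * n + 6) (\<lambda>r'. r' 17 = fst (scan (table k) k ?i ?j n) \<and>
             r' 18 = real (snd (scan (table k) k ?i ?j n)) \<and> r' 19 = w ?i ?j \<and>
             (\<forall>a. a < 12 \<or> 32 \<le> a \<longrightarrow> r' a = u a))"
            using u k by simp
          then show "ok scan_loop u (22 * n + 6) ?Q"
            by (rule ok_mono) (use u c in \<open>auto simp: link_def weight_def\<close>)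
        next
          assume "\<not> u 3 \<le> u 14"
          then have "?k = 0" using u u3 by simp
          then have "cell m = (w ?i ?j, ?i)" using lt by (simp add: cell_def)
          then show "ok (Blk [Copy 17 19, Copy 18 12]) u (22 * n + 6) ?Q"
            using u by (intro ok_wpI) (simp_all add: link_def weight_def)
        qed simp_all
      qed simp
    qed simp_all
  qed (simp add: decode_cell_def)
qed

lemma filled_Suc:
  assumes "filled m r" "m < cells" "r' (vals + m) = fst (cell m)" "r' (links + m) = real (link m)"
    "\<And>a. 32 \<le> a \<Longrightarrow> a \<noteq> vals + m \<Longrightarrow> a \<noteq> links + m \<Longrightarrow> r' a = r a"
  shows "filled (Suc m) r'"
  unfolding filled_def
proof (intro allI impI)
  fix a assume a: "a < Suc m"
  show "r' (vals + a) = fst (cell a) \<and> r' (links + a) = real (link a)"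
  proof (cases "a = m")
    case False
    then show ?thesis using a assms(1,2) by (auto simp: filled_def assms(5))
  qed (simp add: assms(3,4))
qed

lemma final_best_skip:
  assumes "final_best m r" "r' 10 = r 10" "r' 11 = r 11"
    "layer_start \<le> m \<Longrightarrow> 0 \<le> fst (cell m) \<Longrightarrow> fst (cell m) + weight m \<le> r 10"
  shows "final_best (Suc m) r'"
proof -
  have pos: "0 \<le> weight m" by (simp add: weight_def)
  from assms(1) consider
    (none) "r 10 = -1" "\<forall>a<m. layer_start \<le> a \<longrightarrow> fst (cell a) < 0"
    | (some) a where "a < m" "layer_start \<le> a" "0 \<le> fst (cell a)" "r 11 = real a"
        "r 10 = fst (cell a) + weight a"
        "\<forall>b<m. layer_start \<le> b \<longrightarrow> 0 \<le> fst (cell b) \<longrightarrow> fst (cell b) + weight b \<le> r 10"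
    unfolding final_best_def by blast
  then show ?thesis
  proof cases
    case none
    have "fst (cell a) < 0" if a: "a < Suc m" "layer_start \<le> a" for a
    proof (cases "a = m")
      case True
      show ?thesis
      proof (rule ccontr)
        assume "\<not> fst (cell a) < 0"
        \<comment> \<open>A genuine entry in the last layer would have a nonnegative total, which
          cannot stay below the marker.\<close>
        then have "fst (cell m) + weight m \<le> -1" using assms(4) a(2) none(1) True by simp
        with \<open>\<not> fst (cell a) < 0\<close> True pos show False by simp
      qed
    next
      case False
      then show ?thesis using none(2) a by simp
    qed
    then show ?thesis using none(1) assms(2) unfolding final_best_def by simp
  next
    case some
    have "fst (cell b) + weight b \<le> r 10" if "b < Suc m" "layer_start \<le> b" "0 \<le> fst (cell b)" for b
      using some(6) assms(4) that by (cases "b = m") simp_all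
    then show ?thesis
      unfolding final_best_def assms(2,3) using some(1-5) by (intro disjI2 exI[of _ a]) simp
  qed
qed

lemma final_best_update:
  assumes "final_best m r" "r' 10 = fst (cell m) + weight m" "r' 11 = real m"
    "layer_start \<le> m" "0 \<le> fst (cell m)" "\<not> fst (cell m) + weight m \<le> r 10"
  shows "final_best (Suc m) r'"
proof -
  have "fst (cell b) + weight b \<le> r' 10"
    if "b < Suc m" "layer_start \<le> b" "0 \<le> fst (cell b)" for b
  proof (cases "b = m")
    case False
    then have "b < m" using that by simp
    then have "fst (cell b) + weight b \<le> r 10"
      using assms(1) that(2,3) unfolding final_best_def by force
    then show ?thesis using assms(2,6) by linarith
  qed (simp add: assms)
  then show ?thesis unfolding final_best_def using assms by (intro disjI2 exI[of _ m]) simp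
qed

lemma wp_store_cell:
  assumes r: "base r" "filled m r" "m < cells" "r 7 = real m" "final_best m r"
    "r 17 = fst (cell m)" "r 18 = real (link m)" "0 \<le> fst (cell m) \<Longrightarrow> r 19 = weight m"
  shows "wp store_cell r (\<lambda>r'. base r' \<and> filled (Suc m) r' \<and> r' 7 = real (Suc m) \<and>
     final_best (Suc m) r')"
  unfolding store_cell_def
proof (rule wp_SeqI)
  let ?P = "\<lambda>r'. base r' \<and> filled (Suc m) r' \<and> (\<forall>a<32. a \<noteq> 16 \<longrightarrow> r' a = r a)"
  have ad: "r 5 + r 7 = real (vals + m)" "r 6 + r 7 = real (links + m)"
    using r by (simp_all add: base_def)
  show "wp (Blk [Add 16 5 7, StoreInd 16 17, Add 16 6 7, StoreInd 16 18]) r ?P"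
  proof -
    let ?s = "r(16 := links + m, vals + m := fst (cell m), links + m := link m)"
    have "vals + m < mem" "links + m < mem" and "vals \<noteq> links" using r(3) layout by linarith+
    moreover have "base ?s" using r(1) by (simp add: base_def)
    moreover have "filled (Suc m) ?s"
      by (rule filled_Suc[OF r(2,3)]) (use r(3) \<open>vals \<noteq> links\<close> in simp_all)
    ultimately show ?thesis
      using r(1,4,6,7) ad by (simp add: fun_upd_twist base_def)
  qed
next
  fix s assume s: "base s \<and> filled (Suc m) s \<and> (\<forall>a<32. a \<noteq> 16 \<longrightarrow> s a = r a)"
  then have s': "s 7 = real m" "s 17 = fst (cell m)" "0 \<le> fst (cell m) \<Longrightarrow> s 19 = weight m"
    "s 4 = 0" "s 9 = real layer_start" "final_best m s" "s 3 = 1"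
    using r by (auto simp: final_best_def base_def)
  let ?R = "\<lambda>r'. base r' \<and> filled (Suc m) r' \<and> r' 7 = real m \<and> final_best (Suc m) r'"
  have keep: "base (s(17 := x)) = base s" "base (s(17 := x, 10 := y, 11 := z)) = base s"
    "base (s(17 := x, 7 := y)) = base s"
    "filled l (s(17 := x)) = filled l s" "filled l (s(17 := x, 10 := y, 11 := z)) = filled l s"
    for x y z l by (simp_all add: base_def filled_def)
  have pos: "0 \<le> weight b" for b by (simp add: weight_def)
  show "wp (Seq (IfLe 9 7
         (IfLe 4 17
            (Seq (Blk [Add 17 17 19]) (IfLe 17 10 (Blk []) (Blk [Copy 10 17, Copy 11 7])))
            (Blk []))
         (Blk []))
       (Blk [Add 7 7 3])) s (\<lambda>r'. base r' \<and> filled (Suc m) r' \<and> r' 7 = real (Suc m) \<and>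
     final_best (Suc m) r')"
  proof (rule wp_SeqI[where P = ?R])
    have skip: "final_best (Suc m) s" if "\<not> (layer_start \<le> m \<and> 0 \<le> fst (cell m))"
      using that by (intro final_best_skip[OF s'(6)]) simp_all
    have worse: "final_best (Suc m) (s(17 := x))"
      if "fst (cell m) + weight m \<le> s 10" for x
      using that by (intro final_best_skip[OF s'(6)]) simp_all
    have better: "final_best (Suc m) (s(17 := x, 10 := fst (cell m) + weight m, 11 := real m))"
      if "layer_start \<le> m" "0 \<le> fst (cell m)" "\<not> fst (cell m) + weight m \<le> s 10" for x
      using that by (intro final_best_update[OF s'(6)]) simp_all
    show "wp (IfLe 9 7
         (IfLe 4 17
            (Seq (Blk [Add 17 17 19]) (IfLe 17 10 (Blk []) (Blk [Copy 10 17, Copy 11 7])))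
            (Blk []))
         (Blk [])) s ?R"
      using s s' skip worse better by (simp add: keep)
  next
    fix u assume "?R u"
    then show "wp (Blk [Add 7 7 3]) u (\<lambda>r'. base r' \<and> filled (Suc m) r' \<and> r' 7 = real (Suc m) \<and>
      final_best (Suc m) r')"
      by (simp add: base_def filled_def final_best_def)
  qed
qed

section \<open>Reading off and relocating the selection\<close>

lemma ok_backtrack:
  assumes r: "base r" "filled cells r" "r 11 = real m" "m < cells"
  shows "ok backtrack r (12 * p + 3) (\<lambda>r'. base r' \<and> r' 10 = r 10 \<and>
     (\<forall>t<p. r' (Suc out + t) = real ((link ^^ t) m mod n)))"
  unfolding backtrack_def
proof (rule ok_SeqI)
  define I where "I t r' \<longleftrightarrow> base r' \<and> filled cells r' \<and> r' 10 = r 10 \<and> r' 21 = real t \<and>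
    r' 12 = real ((link ^^ t) m) \<and> (\<forall>u<t. r' (Suc out + u) = real ((link ^^ u) m mod n))" for t r'
  show "ok (Blk [Copy 12 11, Const 21 0]) r 2 (I 0)"
    by (rule ok_wpI) (use r in \<open>simp_all add: I_def base_def filled_def\<close>)
  fix r' assume r': "I 0 r'"
  show "ok (WhileLt 21 2 (Blk [Divide 15 12 1, Floor 15 15, Mul 15 15 1, Sub 13 12 15,
        Add 16 0 21, Add 16 16 3, StoreInd 16 13, Add 16 6 12, LoadInd 12 16, Add 21 21 3])) r'
     (p * (10 + 2) + 1)
     (\<lambda>r'. base r' \<and> r' 10 = r 10 \<and> (\<forall>t<p. r' (Suc out + t) = real ((link ^^ t) m mod n)))"
  proof (rule ok_WhileLt[where I = I])
    fix t s assume t: "t < p" and s: "I t s"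
    let ?c = "(link ^^ t) m"
    have c: "?c < cells" using link_pow_le r(4) by (rule le_less_trans)
    define A where "A = Suc out + t"
    have A: "32 \<le> A" "A < vals" "A < mem" "links + ?c < mem" "A \<noteq> links + ?c"
      using t c layout unfolding A_def by linarith+
    have "s 0 + s 21 + 1 = real A" "s 6 + s 12 = real (links + ?c)"
      "s 1 = real n" "s 3 = 1" "s 12 = real ?c"
      using s by (simp_all add: I_def base_def A_def)
    moreover have "s (links + ?c) = real (link ?c)"
      using s c by (simp add: I_def filled_def)
    ultimately have "wp (Blk [Divide 15 12 1, Floor 15 15, Mul 15 15 1, Sub 13 12 15,
        Add 16 0 21, Add 16 16 3, StoreInd 16 13, Add 16 6 12, LoadInd 12 16, Add 21 21 3]) s
        (\<lambda>u. u 12 = real (link ?c) \<and> u 21 = s 21 + 1 \<and> u A = real (?c mod n) \<and>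
          (\<forall>a<12. u a = s a) \<and> (\<forall>a\<ge>32. a \<noteq> A \<longrightarrow> u a = s a))"
      using A by (simp add: floor_div_nat real_mod del: of_nat_add)
    then have "wp (Blk [Divide 15 12 1, Floor 15 15, Mul 15 15 1, Sub 13 12 15,
        Add 16 0 21, Add 16 16 3, StoreInd 16 13, Add 16 6 12, LoadInd 12 16, Add 21 21 3]) s
        (I (Suc t))"
    proof (rule wp_mono)
      fix u :: regs
      assume u: "u 12 = real (link ?c) \<and> u 21 = s 21 + 1 \<and> u A = real (?c mod n) \<and>
          (\<forall>a<12. u a = s a) \<and> (\<forall>a\<ge>32. a \<noteq> A \<longrightarrow> u a = s a)"
      have "base u" using s u by (simp add: I_def base_def)
      moreover have "filled cells u"
      proof -
        \<comment> \<open>The buffer lies below both tables, so writing a point leaves the remaining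
          links intact.\<close>
        have "vals + a \<noteq> A \<and> links + a \<noteq> A" for a using A(2) layout(4) by linarith
        then show ?thesis using s u by (simp add: I_def filled_def)
      qed
      moreover have "u (Suc out + v) = real ((link ^^ v) m mod n)" if "v < Suc t" for v
      proof (cases "v = t")
        case False
        then have "u (Suc out + v) = s (Suc out + v)"
          using u layout(1) by (simp add: A_def)
        then show ?thesis using s that False by (simp add: I_def)
      qed (use u in \<open>simp add: A_def\<close>)
      ultimately show "I (Suc t) u" using s u by (simp add: I_def)
    qed
    then have "ok (Blk [Divide 15 12 1, Floor 15 15, Mul 15 15 1, Sub 13 12 15,
        Add 16 0 21, Add 16 16 3, StoreInd 16 13, Add 16 6 12, LoadInd 12 16, Add 21 21 3]) s
        10 (I (Suc t))"
      by (rule ok_wpI) simp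
    moreover have "s 21 < s 2" using s t by (simp add: I_def base_def)
    ultimately show "s 21 < s 2 \<and> ok (Blk [Divide 15 12 1, Floor 15 15, Mul 15 15 1, Sub 13 12 15,
        Add 16 0 21, Add 16 16 3, StoreInd 16 13, Add 16 6 12, LoadInd 12 16, Add 21 21 3]) s
        10 (I (Suc t))"
      by blast
  qed (use r' in \<open>auto simp: I_def base_def\<close>)
qed simp

lemma ok_move_high:
  assumes "base r"
  shows "ok move_high r (6 * p + 4) (\<lambda>r'. r' 0 = real out \<and> r' (out) = r 10 \<and>
     (\<forall>i. Suc out \<le> i \<longrightarrow> r' i = r i) \<and> (\<forall>i. 32 \<le> i \<longrightarrow> i \<le> p \<longrightarrow> r' i = r (out + i)))"
  unfolding move_high_def
proof (rule ok_SeqI)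
  define I where "I k r' \<longleftrightarrow> r' 0 = real out \<and> r' 2 = real (Suc p) \<and> r' 3 = 1 \<and>
     r' 21 = real (32 + k) \<and> r' (out) = r 10 \<and>
     (\<forall>i. Suc out \<le> i \<longrightarrow> r' i = r i) \<and> (\<forall>i. 32 \<le> i \<longrightarrow> i < 32 + k \<longrightarrow> r' i = r (out + i))" for k r'
  show "ok (Blk [StoreInd 0 10, Const 21 32, Add 2 2 3]) r 3 (I 0)"
    by (rule ok_wpI) (use assms layout in \<open>auto simp: I_def base_def\<close>)
  fix r' assume r': "I 0 r'"
  \<comment> \<open>There are \<open>p - 31\<close> registers from 32 to \<open>p\<close>;
    truncation makes this 0 for smaller \<open>p\<close>.\<close>
  have "ok (WhileLt 21 2 (Blk [Add 16 0 21, LoadInd 22 16, StoreInd 21 22, Add 21 21 3])) r'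
     ((p - 31) * (4 + 2) + 1) (\<lambda>r'. r' 0 = real out \<and> r' (out) = r 10 \<and>
     (\<forall>i. Suc out \<le> i \<longrightarrow> r' i = r i) \<and> (\<forall>i. 32 \<le> i \<longrightarrow> i \<le> p \<longrightarrow> r' i = r (out + i)))"
  proof (rule ok_WhileLt[where I = I])
    fix k s assume k: "k < p - 31" and s: "I k s"
    define A where "A = 32 + k"
    have A: "32 \<le> A" "A < out" "A < mem" "out + A < mem"
      using k layout unfolding A_def by linarith+
    have "s 0 + s 21 = real (out + A)" "s 21 = real A" "s 3 = 1"
      using s by (simp_all add: I_def A_def)
    moreover have "s (out + A) = r (out + A)" using s by (simp add: I_def A_def)
    ultimately have "wp (Blk [Add 16 0 21, LoadInd 22 16, StoreInd 21 22, Add 21 21 3]) s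
        (\<lambda>u. u 21 = s 21 + 1 \<and> u A = r (out + A) \<and> (\<forall>a<16. u a = s a) \<and>
          (\<forall>a\<ge>32. a \<noteq> A \<longrightarrow> u a = s a))"
      using A by (simp del: of_nat_add)
    then have "wp (Blk [Add 16 0 21, LoadInd 22 16, StoreInd 21 22, Add 21 21 3]) s (I (Suc k))"
    proof (rule wp_mono)
      fix u :: regs
      assume u: "u 21 = s 21 + 1 \<and> u A = r (out + A) \<and> (\<forall>a<16. u a = s a) \<and>
          (\<forall>a\<ge>32. a \<noteq> A \<longrightarrow> u a = s a)"
      have "u i = r (out + i)" if "32 \<le> i" "i < 32 + Suc k" for i
      proof (cases "i = A")
        case False
        then show ?thesis using u s that by (simp add: I_def A_def)
      qed (use u in simp)
      moreover have "u i = s i" if "out \<le> i" for i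
        using u that A(1,2) by simp
      ultimately show "I (Suc k) u" using s u by (simp add: I_def)
    qed
    then have "ok (Blk [Add 16 0 21, LoadInd 22 16, StoreInd 21 22, Add 21 21 3]) s 4 (I (Suc k))"
      by (rule ok_wpI) simp
    moreover have "s 21 < s 2" using s k by (simp add: I_def)
    ultimately show "s 21 < s 2 \<and>
       ok (Blk [Add 16 0 21, LoadInd 22 16, StoreInd 21 22, Add 21 21 3]) s 4 (I (Suc k))"
      by blast
  qed (use r' in \<open>auto simp: I_def\<close>)
  then show "ok (WhileLt 21 2 (Blk [Add 16 0 21, LoadInd 22 16, StoreInd 21 22, Add 21 21 3])) r'
     (6 * p + 1) (\<lambda>r'. r' 0 = real out \<and> r' (out) = r 10 \<and>
     (\<forall>i. Suc out \<le> i \<longrightarrow> r' i = r i) \<and> (\<forall>i. 32 \<le> i \<longrightarrow> i \<le> p \<longrightarrow> r' i = r (out + i)))"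
    by (rule ok_mono) auto
qed simp

lemma wp_move_low:
  assumes "r 0 = real out"
  shows "wp move_low r (\<lambda>r'. \<forall>i\<le>p. r' i = r (if i < 32 then out + i else i))"
  unfolding move_low_def
proof (rule wp_SeqI[OF wp_seqs_upt[where I = "\<lambda>t r'. r' 0 = real out \<and>
     (\<forall>i. 1 \<le> i \<longrightarrow> i < t \<longrightarrow> r' i = r (out + i)) \<and> (\<forall>i. 32 \<le> i \<longrightarrow> r' i = r i)"]])
  fix t r' assume t: "1 \<le> t" "t < 32" and r': "r' 0 = real out \<and>
     (\<forall>i. 1 \<le> i \<longrightarrow> i < t \<longrightarrow> r' i = r (out + i)) \<and> (\<forall>i. 32 \<le> i \<longrightarrow> r' i = r i)"
  have "t + out < mem" "out \<noteq> 0" using t layout by linarith+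
  moreover have "r' (t + out) = r (out + t)" using r' layout(1) by (simp add: add.commute)
  ultimately show "wp (Blk [Const t (real t), Add t t 0, LoadInd t t]) r' (\<lambda>r'. r' 0 = real out \<and>
     (\<forall>i. 1 \<le> i \<longrightarrow> i < Suc t \<longrightarrow> r' i = r (out + i)) \<and> (\<forall>i. 32 \<le> i \<longrightarrow> r' i = r i))"
    using t r' by (auto simp: less_Suc_eq)
next
  \<comment> \<open>Register 0 comes last, because it holds the base address for all other
    loads.\<close>
  fix r' assume "r' 0 = real out \<and>
     (\<forall>i. 1 \<le> i \<longrightarrow> i < 32 \<longrightarrow> r' i = r (out + i)) \<and> (\<forall>i. 32 \<le> i \<longrightarrow> r' i = r i)"
  moreover from this have "r' out = r out" using layout(1) by simp
  moreover have "out < mem" using layout by linarith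
  ultimately show "wp (Blk [LoadInd 0 0]) r' (\<lambda>r'. \<forall>i\<le>p. r' i = r (if i < 32 then out + i else i))"
    by auto
qed (use assms in simp_all)

section \<open>Optimality of the best entry and the final bounds\<close>

lemma dp_correct:
  assumes r: "final_best cells r"
  obtains m where "m < cells" "r 11 = real m"
    "\<And>r'. r' 0 = r 10 \<Longrightarrow> \<forall>t<p. r' (Suc t) = real ((link ^^ t) m mod n) \<Longrightarrow> correct_output \<alpha> xs p r'"
proof -
  let ?E = "set xs"
  have E: "front ?E" using pareto by (rule front_set)
  define k where "k = p - 2"
  have pk: "p = Suc (Suc k)" using p2 by (simp add: k_def)
  have lims: "layer_start = k * n * n" "cells = Suc k * n * n"
    unfolding layer_start_def cells_def by (simp_all add: pk)
  define val where "val zs = gap \<alpha> zs 0 + tailval \<alpha> zs" for zs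
  have val_weight: "val (map ((!) xs) (j # i # l)) =
      tailval \<alpha> (map ((!) xs) (j # i # l)) + weight ((k * n + i) * n + j)"
    if "i < n" "j < n" for i j l
    using weight_eq[OF that, of k] by (simp add: val_def gap_def w_def dist_commute)
  \<comment> \<open>The last layer consists of the \<open>n * n\<close> numbers from
    \<open>layer_start\<close> on, so two divisions by \<open>n\<close> give
    \<open>k\<close>.\<close>
  have split: "\<exists>i j. i < n \<and> j < n \<and> m = (k * n + i) * n + j" if "layer_start \<le> m" "m < cells" for m
  proof (intro exI conjI)
    have "m div n div n = k"
      unfolding div_mult2_eq[symmetric]
      by (rule div_nat_eqI) (use that in \<open>simp_all add: lims algebra_simps\<close>)
    then show "m = (k * n + m div n mod n) * n + m mod n"
      by (metis div_mult_mod_eq)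
  qed (use n_pos in simp_all)
  have in_range: "layer_start \<le> (k * n + i) * n + j" "(k * n + i) * n + j < cells" if "i < n" "j < n" for i j
  proof -
    have "(k * n + i) * n + j < (k * n + i) * n + n" using that(2) by simp
    also have "\<dots> = (k * n + Suc i) * n" by simp
    also have "\<dots> \<le> Suc k * n * n" using that by (intro mult_right_mono) auto
    finally show "(k * n + i) * n + j < cells" unfolding lims .
    show "layer_start \<le> (k * n + i) * n + j" by (simp add: lims add_mult_distrib)
  qed
  \<comment> \<open>The entry to compare with is that of the first two points of \<open>ys\<close>;
    both sides then receive the same first gap.\<close>
  have dominated: "\<exists>m<cells. layer_start \<le> m \<and> 0 \<le> fst (cell m) \<and> val ys \<le> fst (cell m) + weight m"
    if ys: "chain ys" "set ys \<subseteq> ?E" "length ys = p" for ys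
  proof -
    have "\<forall>t<p. \<exists>i<n. ys ! t = xs ! i"
      using ys by (metis in_set_conv_nth nth_mem subsetD)
    then obtain f where f: "\<And>t. t < p \<Longrightarrow> f t < n \<and> ys ! t = xs ! f t" by metis
    define l where "l = map (\<lambda>t. f (Suc (Suc t))) [0..<k]"
    have fs: "map f [0..<p] = f 0 # f 1 # l"
      unfolding pk l_def by (simp add: map_upt_Suc del: upt_Suc)
    have "map ((!) xs) (map f [0..<p]) = ys"
      using f ys(3) by (intro nth_equalityI) auto
    then have ys': "map ((!) xs) (f 0 # f 1 # l) = ys" unfolding fs .
    have f01: "f 0 < n" "f 1 < n" using f p2 by auto
    have "\<forall>a\<in>set (map f [0..<p]). a < n" using f by auto
    then have "tailval \<alpha> ys \<le> fst (table k (f 1) (f 0))"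
      using table_complete[of "f 0" "f 1" l] ys(1) ys' unfolding fs by (simp add: l_def)
    then show ?thesis
      using val_weight[OF f01(2,1), of l] cell_eq[OF f01(2,1), of k] in_range[OF f01(2,1)]
        tailval_nonneg[of \<alpha> ys] unfolding ys'
      by (intro exI[of _ "(k * n + f 1) * n + f 0"]) auto
  qed
  have "\<exists>ys. chain ys \<and> set ys \<subseteq> ?E \<and> length ys = p"
  proof -
    have "distinct xs"
      using pareto unfolding pareto_front_def distinct_conv_nth incomp_def prec_def by (metis less_irrefl)
    then have "distinct (take p xs)" by simp
    from ex_chain[OF E this set_take_subset, of \<alpha>] len show ?thesis
      by (metis length_take min.absorb2 set_take_subset)
  qed
  then obtain m0 where "m0 < cells" "layer_start \<le> m0" "0 \<le> fst (cell m0)" using dominated by blast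
  then obtain m where m: "m < cells" "layer_start \<le> m" "0 \<le> fst (cell m)" "r 11 = real m"
    "r 10 = fst (cell m) + weight m"
    "\<And>b. b < cells \<Longrightarrow> layer_start \<le> b \<Longrightarrow> 0 \<le> fst (cell b) \<Longrightarrow> fst (cell b) + weight b \<le> r 10"
    using r unfolding final_best_def by (metis not_le)
  obtain i j where ij: "i < n" "j < n" "m = (k * n + i) * n + j" using split[OF m(2,1)] by blast
  have "0 \<le> fst (table k i j)" using m(3) cell_eq[OF ij(1,2)] ij(3) by simp
  from table_sound[OF ij(1,2) this] obtain l where l: "trace p m = j # i # l"
    "chain (map ((!) xs) (trace p m))" "tailval \<alpha> (map ((!) xs) (trace p m)) = fst (cell m)"
    unfolding ij(3) pk cell_eq[OF ij(1,2)] by metis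
  let ?zs = "map ((!) xs) (trace p m)"
  have len_zs: "length ?zs = p" by (simp add: trace_def)
  have less: "\<forall>a\<in>set (trace p m). a < n" using n_pos by (auto simp: trace_def)
  then have sub: "set ?zs \<subseteq> ?E" by auto
  have v: "val ?zs = r 10"
    using val_weight[OF ij(1,2), of l] l m(5) ij(3) by simp
  have opt: "?zs \<in> tuples p ?E" "dispersion \<alpha> ?zs = opt_value \<alpha> p ?E" "opt_value \<alpha> p ?E = val ?zs"
    unfolding val_def
    by (rule opt_valueI[OF E _ _ l(2) sub alpha, unfolded len_zs], simp, fact p2,
        use dominated m(6) v in \<open>fastforce simp: val_def\<close>)+
  show thesis
  proof (rule that[OF m(1,4)])
    fix r' :: regs assume r': "r' 0 = r 10" "\<forall>t<p. r' (Suc t) = real ((link ^^ t) m mod n)"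
    have "map (\<lambda>i. idx (r' (Suc i))) [0..<p] = trace p m"
      using r'(2) by (auto simp: trace_def)
    then show "correct_output \<alpha> xs p r'"
      unfolding correct_output_def Let_def using opt less r'(1) v by simp
  qed
qed

lemma ok_dynamic_program:
  "ok dynamic_program (\<lambda>_. 0) (17 + ((cells * ((22 * n + 45) + 2) + 1) + ((12 * p + 3) + ((6 * p + 4) + 94))))
     (correct_output \<alpha> xs p)"
  unfolding dynamic_program_def
proof (rule ok_SeqI[OF ok_wpI[OF wp_init order_refl]])
  let ?I = "\<lambda>m r. base r \<and> filled m r \<and> r 7 = real m \<and> final_best m r"
  fix r assume r: "base r \<and> r 7 = 0 \<and> final_best 0 r"
  show "ok (Seq (WhileLt 7 8 (Seq compute_cell store_cell))
     (Seq backtrack (Seq move_high move_low))) r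
     ((cells * ((22 * n + 45) + 2) + 1) + ((12 * p + 3) + ((6 * p + 4) + 94))) (correct_output \<alpha> xs p)"
  proof (rule ok_SeqI)
    show "ok (WhileLt 7 8 (Seq compute_cell store_cell)) r (cells * ((22 * n + 45) + 2) + 1) (?I cells)"
    proof (rule ok_WhileLt[where I = ?I])
      fix m s assume m: "m < cells" and s: "?I m s"
      have "ok (Seq compute_cell store_cell) s (22 * n + 45) (?I (Suc m))"
      proof (rule ok_SeqI[OF ok_compute_cell ok_wpI])
        fix u assume u: "u 17 = fst (cell m) \<and> u 18 = real (link m) \<and>
          (0 \<le> fst (cell m) \<longrightarrow> u 19 = weight m) \<and> (\<forall>a. a < 12 \<or> 32 \<le> a \<longrightarrow> u a = s a)"
        then have "base u" "filled m u" "final_best m u" "u 7 = real m"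
          using s by (simp_all add: base_def filled_def final_best_def)
        then show "wp store_cell u (?I (Suc m))"
          using m u by (intro wp_store_cell) auto
        show "cost store_cell \<le> 20" by (simp add: store_cell_def)
      qed (use m s in auto)
      then show "s 7 < s 8 \<and> ok (Seq compute_cell store_cell) s (22 * n + 45) (?I (Suc m))"
        using m s by (simp add: base_def del: of_nat_mult)
    qed (use r in \<open>auto simp: base_def filled_def\<close>)
  next
    fix s assume s: "?I cells s"
    obtain m where m: "m < cells" "s 11 = real m"
      "\<And>r'. r' 0 = s 10 \<Longrightarrow> \<forall>t<p. r' (Suc t) = real ((link ^^ t) m mod n) \<Longrightarrow> correct_output \<alpha> xs p r'"
      using dp_correct[of s] s by blast
    show "ok (Seq backtrack (Seq move_high move_low)) s ((12 * p + 3) + ((6 * p + 4) + 94))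
       (correct_output \<alpha> xs p)"
    proof (rule ok_SeqI[OF ok_backtrack[of s m]])
      fix u assume u: "base u \<and> u 10 = s 10 \<and> (\<forall>t<p. u (Suc out + t) = real ((link ^^ t) m mod n))"
      show "ok (Seq move_high move_low) u ((6 * p + 4) + 94) (correct_output \<alpha> xs p)"
      proof (rule ok_SeqI[OF ok_move_high ok_wpI])
        fix v assume v: "v 0 = real out \<and> v (out) = u 10 \<and>
          (\<forall>i. Suc out \<le> i \<longrightarrow> v i = u i) \<and> (\<forall>i. 32 \<le> i \<longrightarrow> i \<le> p \<longrightarrow> v i = u (out + i))"
        show "wp move_low v (correct_output \<alpha> xs p)"
        proof (rule wp_mono[OF wp_move_low])
          fix r' assume r': "\<forall>i\<le>p. r' i = v (if i < 32 then out + i else i)"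
          have "r' 0 = s 10" using r' u v by simp
          moreover have "r' (Suc t) = real ((link ^^ t) m mod n)" if "t < p" for t
          proof -
            have "r' (Suc t) = u (out + Suc t)" using r' v that by simp
            then show ?thesis using u that by simp
          qed
          ultimately show "correct_output \<alpha> xs p r'" using m(3) by blast
        qed (use v in simp)
        \<comment> \<open>Three instructions for each of the registers 1 to 31, and one for register
          0.\<close>
        show "cost move_low \<le> 94" by (simp add: move_low_def upt_rec)
      qed (use u in simp_all)
    qed (use s m in auto)
  qed simp
qed (simp add: init_dp_def)

theorem dynamic_program_solves:
  "solves_within (comp 0 dynamic_program) \<alpha> xs p (300 * real p * real n ^ 3) (300 * real p * real n ^ 2)"
proof (rule solves_withinI[OF ok_dynamic_program])
  have n: "1 \<le> n" using n_pos by linarith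
  have p: "1 \<le> p" using p2 by simp
  have cells: "cells \<le> p * n ^ 2" by (simp add: cells_def power2_eq_square mult.assoc)
  have n2: "p * 1 \<le> p * n ^ 2" using n by (intro mult_le_mono2 one_le_power)
  have n3: "p * n ^ 2 \<le> p * n ^ 3" using n by (intro mult_le_mono2 power_increasing) auto
  \<comment> \<open>Here \<open>47 \<le> 47 * n\<close> gives the factor 69; the remaining costs are
    linear in \<open>p\<close> and fit into the slack up to 300.\<close>
  have "cells * (22 * n + 45 + 2) \<le> (p * n ^ 2) * (69 * n)"
    using n by (intro mult_le_mono cells) linarith
  also have "\<dots> = 69 * (p * n ^ 3)" by (simp add: power2_eq_square power3_eq_cube)
  finally have "17 + ((cells * ((22 * n + 45) + 2) + 1) + ((12 * p + 3) + ((6 * p + 4) + 94)))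
     \<le> 300 * (p * n ^ 3)" using n2 n3 p by linarith
  then show "real (17 + ((cells * ((22 * n + 45) + 2) + 1) + ((12 * p + 3) + ((6 * p + 4) + 94))))
     \<le> 300 * real p * real n ^ 3"
    by (metis (no_types, lifting) mult.assoc of_nat_le_iff of_nat_mult of_nat_numeral of_nat_power)
  have "mem \<le> 300 * (p * n ^ 2)"
    using cells n2 p unfolding mem cells_def by linarith
  then show "real mem \<le> 300 * real p * real n ^ 2"
    by (metis (no_types, lifting) mult.assoc of_nat_le_iff of_nat_mult of_nat_numeral of_nat_power)
qed

end

lemma dp_solves:
  assumes "0 < \<alpha>" "valid_instance xs p"
  shows "solves_within (comp 0 dynamic_program) \<alpha> xs p
    (300 * real p * real (length xs) ^ 3) (300 * real p * real (length xs) ^ 2)"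
proof -
  interpret dp \<alpha> xs p "100 + 2 * p + 2 * ((p - 1) * length xs * length xs)"
    using assms by unfold_locales (auto simp: valid_instance_def)
  show ?thesis by (rule dynamic_program_solves)
qed

theorem theorem3:
  fixes \<alpha> :: real
  assumes "\<alpha> > 0"
  shows
   "(\<exists>prog (c::real) (k::nat). \<forall>xs p. valid_instance xs p \<longrightarrow>
        solves_within prog \<alpha> xs p (c * real (length xs) ^ k) (c * real (length xs) ^ k))
  \<and> (\<forall>p\<in>{2, 3}. \<exists>prog (c::real). \<forall>xs. valid_instance xs p \<longrightarrow>
        solves_within prog \<alpha> xs p (c * real (length xs)) c)
  \<and> (\<exists>prog (c::real). \<forall>xs. valid_instance xs 4 \<longrightarrow>
        solves_within prog \<alpha> xs 4 (c * real (length xs) ^ 2) c)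
  \<and> (\<exists>prog (c::real). \<forall>xs. valid_instance xs 5 \<longrightarrow>
        solves_within prog \<alpha> xs 5 (c * real (length xs) ^ 3) c)
  \<and> (\<exists>prog (c::real). \<forall>xs p. valid_instance xs p \<and> p > 5 \<longrightarrow>
        solves_within prog \<alpha> xs p (c * real p * real (length xs) ^ 3)
                                   (c * real p * real (length xs) ^ 2))"
proof (intro conjI ballI)
  show "\<exists>prog (c::real) (k::nat). \<forall>xs p. valid_instance xs p \<longrightarrow>
      solves_within prog \<alpha> xs p (c * real (length xs) ^ k) (c * real (length xs) ^ k)"
  \<comment> \<open>One program serves every \<open>p\<close>, and \<open>p \<le> n\<close> turns
    \<open>p * n ^ 3\<close> into \<open>n ^ 4\<close>.\<close>
  proof (intro exI[of _ "comp 0 dynamic_program"] exI[of _ "300::real"] exI[of _ "4::nat"] allI impI)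
    fix xs p assume v: "valid_instance xs p"
    let ?n = "real (length xs)"
    have p: "real p \<le> ?n" and n: "1 \<le> ?n"
      using v by (simp_all add: valid_instance_def)
    have "real p * ?n ^ 3 \<le> ?n * ?n ^ 3" "real p * ?n ^ 2 \<le> ?n * ?n ^ 2"
      using p by (intro mult_right_mono; simp)+
    moreover have "?n ^ 3 \<le> ?n ^ 4" using n by (intro power_increasing) auto
    ultimately have "300 * real p * ?n ^ 3 \<le> 300 * ?n ^ 4" "300 * real p * ?n ^ 2 \<le> 300 * ?n ^ 4"
      by (simp_all flip: power_Suc)
    then show "solves_within (comp 0 dynamic_program) \<alpha> xs p (300 * ?n ^ 4) (300 * ?n ^ 4)"
      by (rule solves_within_mono[OF dp_solves[OF assms v]])
  qed
next
  fix p :: nat assume "p \<in> {2, 3}"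
  then obtain q where "p = Suc (Suc q)" "max 1 q = 1" by fastforce
  then show "\<exists>prog (c::real). \<forall>xs. valid_instance xs p \<longrightarrow>
      solves_within prog \<alpha> xs p (c * real (length xs)) c"
    using brute_solves[OF assms, of q] by simp
next
  show "\<exists>prog (c::real). \<forall>xs. valid_instance xs 4 \<longrightarrow>
      solves_within prog \<alpha> xs 4 (c * real (length xs) ^ 2) c"
    using brute_solves[OF assms, of 2] by (simp add: numeral_eq_Suc)
next
  show "\<exists>prog (c::real). \<forall>xs. valid_instance xs 5 \<longrightarrow>
      solves_within prog \<alpha> xs 5 (c * real (length xs) ^ 3) c"
    using brute_solves[OF assms, of 3] by (simp add: numeral_eq_Suc)
next
  show "\<exists>prog (c::real). \<forall>xs p. valid_instance xs p \<and> p > 5 \<longrightarrow>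
      solves_within prog \<alpha> xs p (c * real p * real (length xs) ^ 3)
                                 (c * real p * real (length xs) ^ 2)"
    using dp_solves[OF assms] by blast
qed

end
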